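(* For any infinite $E\subset\mathbb{N}$, there exists a chromatically $E$-intersective set which is not intersective (and thus not $E$-intersective).
   Context: $\mathbb{N}=\{1,2,3,\dots\}$, $[N]=\{1,\dots,N\}$. For $A,E\subset\mathbb{N}$, $E$ infinite, $\overline{d}_E(A)=\limsup_{N\to\infty}\frac{|A\cap E\cap[N]|}{|E\cap[N]|}$. $A-A=\{a-b:a,b\in A\}$. A set $R\subset\mathbb{N}$ is $E$-intersective if for every $A\subset E$ with $\overline{d}_E(A)>0$ we have $R\cap(A-A)\neq\varnothing$; intersective means $\mathbb{N}$-intersective. $R$ is chromatically $E$-intersective if for every finite partition $E=\bigcup_{i=1}^kE_i$ there exists $i$ with $R\cap(E_i-E_i)\neq\varnothing$. *)

theory Defs
  imports Complex_Main "HOL-Library.Extended_Real" "HOL-Library.Liminf_Limsup"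
    "HOL-Library.Disjoint_Sets"
begin

text \<open>
  Subsets of the positive integers are represented as sets of type \<^typ>\<open>nat set\<close>
  contained in \<open>{1..}\<close>.
\<close>

text \<open>
  The limes superior is taken in \<^typ>\<open>ereal\<close>. The finitely many quotients with
  \<open>E \<inter> {1..N} = {}\<close> have the value 0 and do not influence it.
\<close>

definition rel_upper_density :: "nat set \<Rightarrow> nat set \<Rightarrow> ereal" where
  "rel_upper_density E A =
     limsup (\<lambda>N. ereal (real (card (A \<inter> E \<inter> {1..N})) / real (card (E \<inter> {1..N}))))"

text \<open>Differences are formed in the integers, since subtraction on \<^typ>\<open>nat\<close> truncates.\<close>

definition difference_set :: "nat set \<Rightarrow> int set" where
  "difference_set A = {int a - int b | a b. a \<in> A \<and> b \<in> A}"

definition E_intersective :: "nat set \<Rightarrow> nat set \<Rightarrow> bool" where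
  "E_intersective E R \<longleftrightarrow>
     (\<forall>A. A \<subseteq> E \<and> rel_upper_density E A > 0 \<longrightarrow> int ` R \<inter> difference_set A \<noteq> {})"

definition intersective :: "nat set \<Rightarrow> bool" where
  "intersective R \<longleftrightarrow> E_intersective {1..} R"

definition chromatically_E_intersective :: "nat set \<Rightarrow> nat set \<Rightarrow> bool" where
  "chromatically_E_intersective E R \<longleftrightarrow>
     (\<forall>P. finite P \<and> partition_on E P \<longrightarrow> (\<exists>C\<in>P. int ` R \<inter> difference_set C \<noteq> {}))"

end

theory Submission
  imports Defs "HOL-Library.Multiset" "HOL-Library.FuncSet" "HOL-Library.Infinite_Set"
begin

text \<open>
  This is a version of Kriz's construction. By Tucker's lemma, every colouring of the cube
  \<open>{0,1}\<^sup>d\<close> with \<open>k \<le> d\<close> colours has a monochromatic pair of points that differ in more than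
  \<open>d - k\<close> coordinates. For every \<open>k\<close> choose numbers \<open>e v \<in> E\<close>, indexed by the points of a cube of
  large dimension \<open>d\<close>, and a rotation \<open>n \<mapsto> (n a\<^sub>i)\<^sub>i\<close> such that \<open>e v a\<^sub>i\<close> is close to an integer of parity
  \<open>v\<^sub>i\<close>. The differences \<open>e v - e w\<close> of far pairs form a finite set \<open>R\<^sub>k\<close>, and the union of the \<open>R\<^sub>k\<close> is
  chromatically \<open>E\<close>-intersective. The choices are made so that \<open>R\<^sub>j\<close> hardly moves the \<open>k\<close>-th torus
  for \<open>j \<noteq> k\<close>.

  Call \<open>n\<close> bad at level \<open>k\<close> if the bits of its (translated) image in the \<open>k\<close>-th torus are unstable or
  nearly balanced. Off the bad numbers, adding an element of \<open>R\<^sub>k\<close> flips the majority bit of level \<open>k\<close>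
  and keeps those of all other levels, so the graph given by \<open>R\<close> on these numbers is bipartite.
  Averaging over translations makes the bad numbers of all levels together occupy at most half of any
  prescribed infinite set \<open>F\<close> along a sequence of initial segments, so one of the two sides of the
  bipartition has relative upper density at least \<open>1/4\<close> in \<open>F\<close>. This is used for \<open>F = E\<close> and for
  \<open>F = {1..}\<close>.
\<close>

section \<open>Tucker's lemma\<close>

lemma sum_of_bool_card:
  assumes "finite A"
  shows "(\<Sum>x\<in>A. of_bool (P x) :: nat) = card {x \<in> A. P x}"
proof -
  have "(\<Sum>x\<in>A. of_bool (P x) :: nat) = (\<Sum>x\<in>{x \<in> A. P x}. 1)"
    using assms by (intro sum.mono_neutral_cong_right) auto
  then show ?thesis by simp
qed

lemma even_card_involution:
  assumes "finite A" and "\<And>x. x \<in> A \<Longrightarrow> f x \<in> A"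
    and "\<And>x. x \<in> A \<Longrightarrow> f (f x) = x" and "\<And>x. x \<in> A \<Longrightarrow> f x \<noteq> x"
  shows "even (card A)"
  using assms
proof (induction "card A" arbitrary: A rule: less_induct)
  case less
  show ?case
  proof (cases "A = {}")
    case False
    then obtain x where x: "x \<in> A" by blast
    let ?B = "A - {x, f x}"
    have c: "card A = card ?B + 2"
    proof -
      have "f x \<noteq> x" "f x \<in> A" using less.prems x by auto
      then have "card {x, f x} = 2" "{x, f x} \<subseteq> A" using x by auto
      then show ?thesis using less.prems(1)
        by (metis card_Diff_subset card_mono finite_subset le_add_diff_inverse2)
    qed
    have "even (card ?B)"
    proof (rule less.hyps)
      fix y assume y: "y \<in> ?B"
      then show "f y \<in> ?B" using less.prems(2,3) x by (metis Diff_iff insert_iff empty_iff)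
    qed (use c less.prems in auto)
    then show ?thesis using c by simp
  qed simp
qed

section \<open>Alternating label lists and the parity of their deletions\<close>

fun alternating :: "bool \<Rightarrow> nat list \<Rightarrow> bool" where
  "alternating b [] \<longleftrightarrow> True"
| "alternating b (x # xs) \<longleftrightarrow> even x = b \<and> alternating (\<not> b) xs"

definition alternating_mset :: "bool \<Rightarrow> nat multiset \<Rightarrow> bool" where
  "alternating_mset b M = alternating b (sorted_list_of_multiset M)"

text \<open>If \<open>x = y\<close>, sortedness puts this second copy of \<open>y\<close> at the
  head of \<open>ys\<close>, and deleting either copy gives the same list.\<close>

lemma remove1_Cons_sorted:
  assumes "sorted (y # ys)" "x \<in> set ys"
  shows "remove1 x (y # ys) = y # remove1 x ys"
  using assms by (cases ys) auto

text \<open>The local door count in Ky Fan's argument. A nonempty alternating list has exactly one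
  deletion that is alternating from \<open>b\<close>: the last entry goes if the list starts with
  parity \<open>b\<close>, the first one otherwise. A list that is not alternating but has such a
  deletion contains one pair of neighbours of equal parity, and either of the two may go.\<close>

lemma sum_list_alternating_remove1:
  assumes "sorted xs"
  shows "even ((\<Sum>x\<leftarrow>xs. of_bool (alternating b (remove1 x xs)) :: nat)
     + of_bool (alternating b xs) + of_bool (alternating (\<not> b) xs))"
  using assms
proof (induction xs arbitrary: b)
  case (Cons y ys)
  define s where "s = (\<Sum>x\<leftarrow>y # ys. of_bool (alternating b (remove1 x (y # ys))) :: nat)"
  have "map (\<lambda>x. of_bool (alternating b (remove1 x (y # ys))) :: nat) ys
      = map (\<lambda>x. of_bool (alternating b (y # remove1 x ys))) ys"
    using remove1_Cons_sorted[OF Cons.prems] by (intro map_cong) (auto simp del: remove1.simps)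
  then have "s = of_bool (alternating b ys) + (\<Sum>x\<leftarrow>ys. of_bool (alternating b (y # remove1 x ys)))"
    by (simp only: s_def list.map sum_list.Cons remove1.simps(2)[of y y] if_True simp_thms)
  then have "s = of_bool (alternating b ys)
      + (if even y = b then \<Sum>x\<leftarrow>ys. of_bool (alternating (\<not> b) (remove1 x ys)) else 0)"
    by simp
  moreover have "even ((\<Sum>x\<leftarrow>ys. of_bool (alternating (\<not> b) (remove1 x ys)) :: nat)
     + of_bool (alternating (\<not> b) ys) + of_bool (alternating b ys))"
    using Cons.IH[of "\<not> b"] Cons.prems by simp
  ultimately have "even (s + of_bool (even y = b \<and> alternating (\<not> b) ys)
      + of_bool (even y = (\<not> b) \<and> alternating b ys))"
    by (cases "even y = b"; cases "alternating b ys"; cases "alternating (\<not> b) ys") simp_all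
  then show ?case by (simp only: s_def alternating.simps not_not)
qed simp

lemma sum_alternating_mset_diff:
  "even ((\<Sum>x\<in>#M. of_bool (alternating_mset b (M - {#x#})) :: nat)
     + of_bool (alternating_mset b M) + of_bool (alternating_mset (\<not> b) M))"
proof -
  let ?l = "sorted_list_of_multiset M"
  have "sorted_list_of_multiset (M - {#x#}) = remove1 x ?l" for x
    by (metis mset_remove1 mset_sorted_list_of_multiset sorted_list_of_multiset_mset
        sorted_remove1 sorted_sort_id sorted_sorted_list_of_multiset)
  moreover have "(\<Sum>x\<in>#M. f x) = (\<Sum>x\<leftarrow>?l. f x)" for f :: "nat \<Rightarrow> nat"
    by (metis mset_map mset_sorted_list_of_multiset sum_mset_sum_list)
  ultimately show ?thesis
    using sum_list_alternating_remove1[of ?l b] by (simp add: alternating_mset_def)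
qed

text \<open>The numbers \<open>2 * j\<close> and \<open>2 * j + 1\<close> stand for the opposite labels \<open>+j\<close> and \<open>-j\<close>. A set of
  labels that contains no opposite pair is alternating in the sense of Ky Fan iff its increasing
  enumeration alternates in parity.\<close>

definition flip :: "nat \<Rightarrow> nat" where
  "flip a = (if even a then Suc a else a - 1)"

lemma flip_simps [simp]:
  "even (flip a) \<longleftrightarrow> odd a" "flip (flip a) = a" "flip a div 2 = a div 2" "flip a \<noteq> a"
  by (auto simp: flip_def elim!: evenE oddE)

text \<open>\<open>flip\<close> permutes each block of two opposite labels, so it reverses the order
  only inside a block.\<close>

lemma flip_strict_mono: "a < b \<Longrightarrow> b \<noteq> flip a \<Longrightarrow> flip a < flip b"
  by (auto simp: flip_def elim!: evenE oddE split: if_splits)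

lemma div2_eq_cases: "a div 2 = b div 2 \<Longrightarrow> b = a \<or> b = flip a"
  by (auto simp: flip_def elim!: evenE oddE; presburger)

lemma alternating_map_flip [simp]: "alternating b (map flip xs) = alternating (\<not> b) xs"
  by (induction xs arbitrary: b) auto

text \<open>Without opposite labels \<open>flip\<close> preserves the order, so the increasing
  enumeration is mapped entry by entry and all parities change.\<close>

lemma alternating_mset_image_flip:
  assumes "\<And>x y. x \<in># M \<Longrightarrow> y \<in># M \<Longrightarrow> y \<noteq> flip x"
  shows "alternating_mset b (image_mset flip M) = alternating_mset (\<not> b) M"
proof -
  let ?l = "sorted_list_of_multiset M"
  have "sorted_wrt (\<lambda>x y. flip x \<le> flip y) ?l"
  proof (rule sorted_wrt_mono_rel[OF _ sorted_sorted_list_of_multiset])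
    fix x y assume "x \<in> set ?l" "y \<in> set ?l" "x \<le> y"
    then show "flip x \<le> flip y"
      using flip_strict_mono[of x y] assms[of x y] by (cases "x = y") auto
  qed
  then have "sorted (map flip ?l)" by (simp add: sorted_wrt_map)
  then have "sorted_list_of_multiset (image_mset flip M) = map flip ?l"
    by (metis mset_map mset_sorted_list_of_multiset sorted_list_of_multiset_mset sorted_sort_id)
  then show ?thesis by (simp add: alternating_mset_def)
qed

lemma alternating_sorted_distinct:
  "sorted xs \<Longrightarrow> alternating b xs \<Longrightarrow> distinct xs"
proof (induction xs arbitrary: b)
  case (Cons x xs)
  then have d: "distinct xs" by auto
  have "x \<notin> set xs"
  proof
    assume "x \<in> set xs"
    then obtain y ys where xs: "xs = y # ys" by (cases xs) auto
    with \<open>x \<in> set xs\<close> Cons.prems(1) have "y = x" by auto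
    then show False using Cons.prems(2) xs by auto
  qed
  with d show ?case by simp
qed simp

section \<open>Maximal chains of sign vectors and Ky Fan's parity argument\<close>

text \<open>A list \<open>xs\<close> in \<open>signed_perms n\<close> encodes a maximal chain of sign vectors: its \<open>j\<close>-th member
  has the value \<open>sgn a\<close> at \<open>\<bar>a\<bar>\<close> for the first \<open>j\<close> entries \<open>a\<close> of \<open>xs\<close>, and \<open>0\<close> elsewhere.\<close>

definition signed_perms :: "nat \<Rightarrow> int list set" where
  "signed_perms n = {xs. length xs = n \<and> distinct (map abs xs) \<and> abs ` set xs = {1..int n}}"

text \<open>The index \<open>j\<close> stands for the chain member with \<open>Suc j\<close> nonzero
  entries, so leaving one index out of \<open>{..<n}\<close> describes a facet of the simplex
  spanned by the chain.\<close>

definition chain_labels :: "(int set \<Rightarrow> nat) \<Rightarrow> int list \<Rightarrow> nat set \<Rightarrow> nat multiset" where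
  "chain_labels l xs I = image_mset (\<lambda>j. l (set (take (Suc j) xs))) (mset_set I)"

lemma finite_signed_perms: "finite (signed_perms n)"
proof (rule finite_subset)
  show "signed_perms n \<subseteq> {xs. set xs \<subseteq> {- int n..int n} \<and> length xs = n}"
  proof
    fix xs assume "xs \<in> signed_perms n"
    then have *: "length xs = n" "abs ` set xs = {1..int n}" by (auto simp: signed_perms_def)
    have "x \<in> {- int n..int n}" if "x \<in> set xs" for x
    proof -
      have "\<bar>x\<bar> \<in> {1..int n}" using that * by blast
      then show ?thesis by auto
    qed
    with * show "xs \<in> {xs. set xs \<subseteq> {- int n..int n} \<and> length xs = n}" by auto
  qed
qed (simp add: finite_lists_length_eq)

lemma signed_perms_not_uminus:
  assumes "xs \<in> signed_perms n" "a \<in> set xs" shows "- a \<notin> set xs"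
proof
  assume "- a \<in> set xs"
  moreover have "\<bar>a\<bar> \<in> {1..int n}" "inj_on abs (set xs)"
    using assms by (auto simp: signed_perms_def distinct_map)
  ultimately have "- a = a" using assms(2) by (auto dest: inj_onD[where x = a and y = "- a"])
  then show False using \<open>\<bar>a\<bar> \<in> {1..int n}\<close> by auto
qed

lemma signed_perms_mem_iff:
  assumes "xs \<in> signed_perms n" "n > 0" shows "- int n \<in> set xs \<longleftrightarrow> int n \<notin> set xs"
proof -
  have "int n \<in> abs ` set xs" using assms by (auto simp: signed_perms_def)
  then show ?thesis using signed_perms_not_uminus[OF assms(1), of "int n"]
    by (metis abs_if add.inverse_inverse imageE)
qed

lemma uminus_signed_perms: "map uminus xs \<in> signed_perms n \<longleftrightarrow> xs \<in> signed_perms n"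
  by (simp add: signed_perms_def image_image o_def)

text \<open>A nonzero sign vector is encoded as the set of the integers \<open>\<plusminus>i\<close> at whose index \<open>i\<close> it has the
  value \<open>\<plusminus>1\<close>.\<close>

definition sign_vectors :: "nat \<Rightarrow> int set set" where
  "sign_vectors n = {X. X \<noteq> {} \<and> abs ` X \<subseteq> {1..int n} \<and> X \<inter> uminus ` X = {}}"

lemma take_sign_vectors:
  assumes "xs \<in> signed_perms n" "j < n"
  shows "set (take (Suc j) xs) \<in> sign_vectors n"
proof -
  have "set (take (Suc j) xs) \<subseteq> set xs" by (rule set_take_subset)
  moreover have "set (take (Suc j) xs) \<noteq> {}" using assms by (auto simp: signed_perms_def)
  ultimately show ?thesis using assms signed_perms_not_uminus[OF assms(1)]
    unfolding sign_vectors_def signed_perms_def by blast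
qed

text \<open>Comparable sign vectors are the edges of the barycentric subdivision of the octahedral
  sphere: the labelling is antipodal and has no complementary edge.\<close>

definition tucker_labelling :: "nat \<Rightarrow> (int set \<Rightarrow> nat) \<Rightarrow> bool" where
  "tucker_labelling n l \<longleftrightarrow>
     (\<forall>X\<in>sign_vectors n. l (uminus ` X) = flip (l X)) \<and>
     (\<forall>X\<in>sign_vectors n. \<forall>Y\<in>sign_vectors n. X \<subseteq> Y \<longrightarrow> l Y \<noteq> flip (l X))"

lemma tucker_labelling_mono:
  assumes "tucker_labelling (Suc n) l" shows "tucker_labelling n l"
proof -
  have "X \<in> sign_vectors (Suc n)" if "X \<in> sign_vectors n" for X
    using that by (auto simp: sign_vectors_def)
  then show ?thesis using assms by (simp add: tucker_labelling_def)
qed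

lemma chain_labels_no_flip:
  assumes "tucker_labelling n l" "xs \<in> signed_perms n"
    and "x \<in># chain_labels l xs {..<n}" "y \<in># chain_labels l xs {..<n}"
  shows "y \<noteq> flip x"
proof -
  obtain i j where ij: "i < n" "j < n" "x = l (set (take (Suc i) xs))" "y = l (set (take (Suc j) xs))"
    using assms(3,4) by (auto simp: chain_labels_def)
  let ?X = "set (take (Suc i) xs)" and ?Y = "set (take (Suc j) xs)"
  have "?X \<subseteq> ?Y \<or> ?Y \<subseteq> ?X"
    by (meson Suc_le_mono linear set_take_subset_set_take)
  moreover have "?X \<in> sign_vectors n" "?Y \<in> sign_vectors n"
    using take_sign_vectors assms(2) ij by auto
  ultimately show ?thesis using assms(1) ij unfolding tucker_labelling_def
    by (metis flip_simps(2))
qed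

lemma alternating_chain_uminus:
  assumes "tucker_labelling n l" "xs \<in> signed_perms n"
  shows "alternating_mset b (chain_labels l (map uminus xs) {..<n})
    = alternating_mset (\<not> b) (chain_labels l xs {..<n})"
proof -
  have "l (set (take (Suc j) (map uminus xs))) = flip (l (set (take (Suc j) xs)))" if "j < n" for j
    using assms(1) take_sign_vectors[OF assms(2) that]
    by (simp add: tucker_labelling_def take_map)
  then have "chain_labels l (map uminus xs) {..<n} = image_mset flip (chain_labels l xs {..<n})"
    unfolding chain_labels_def by (auto simp: multiset.map_comp intro!: image_mset_cong)
  then show ?thesis
    using alternating_mset_image_flip chain_labels_no_flip[OF assms] by metis
qed

text \<open>The other maximal chain through the facet opposite to member \<open>i\<close>. Swapping
  two consecutive entries changes only that member; at the last index the sign of the last entry is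
  changed, which affects only the top member.\<close>

definition chain_neighbour :: "int list \<times> nat \<Rightarrow> int list \<times> nat" where
  "chain_neighbour = (\<lambda>(xs, i). if Suc i < length xs then (xs[i := xs ! Suc i, Suc i := xs ! i], i)
     else (xs[i := - (xs ! i)], i))"

lemma set_take_swap:
  assumes "Suc i < length xs" "j \<noteq> i"
  shows "set (take (Suc j) (xs[i := xs ! Suc i, Suc i := xs ! i])) = set (take (Suc j) xs)"
proof (cases "j < i")
  case True
  then show ?thesis by simp
next
  case False
  let ?ys = "take (Suc j) xs"
  have ij: "Suc i < length ?ys" using assms False by auto
  have "take (Suc j) (xs[i := xs ! Suc i, Suc i := xs ! i]) = ?ys[i := ?ys ! Suc i, Suc i := ?ys ! i]"
    using assms False by (simp add: take_update_swap)
  then show ?thesis using ij by (metis Suc_lessD set_swap)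
qed

text \<open>Double counting of the alternating facets in a hemisphere: \<open>chain_neighbour\<close> pairs off the two
  chains that share a facet, and only the facets on the equator are left over.\<close>

lemma card_facets:
  assumes "n > 0"
  defines "U \<equiv> {xs \<in> signed_perms n. int n \<in> set xs}"
  shows "even (card {(xs, i). xs \<in> U \<and> i < n \<and> alternating_mset b (chain_labels l xs ({..<n} - {i}))}
    + card {ys \<in> signed_perms (n - 1). alternating_mset b (chain_labels l ys {..<n - 1})})"
    (is "even (card ?S + card ?Q)")
proof -
  \<comment> \<open>These facets lie on the equator: their neighbour has \<open>- int n\<close> as
    last entry and so leaves the hemisphere \<open>U\<close>.\<close>
  let ?F = "{(xs, i) \<in> ?S. i = n - 1 \<and> xs ! i = int n}"
  let ?D = "?S - ?F"
  have finU: "finite U" using finite_signed_perms by (simp add: U_def)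
  have fin: "finite ?S"
    by (rule finite_subset[of _ "U \<times> {..<n}"]) (auto simp: finU)
  have evenD: "even (card ?D)"
  proof (rule even_card_involution[where f = chain_neighbour])
    show "finite ?D" using fin by simp
  next
    fix p assume p: "p \<in> ?D"
    obtain xs i where pe: "p = (xs, i)" by fastforce
    have xs: "xs \<in> signed_perms n" "int n \<in> set xs" "i < n"
      "alternating_mset b (chain_labels l xs ({..<n} - {i}))"
      "\<not> (i = n - 1 \<and> xs ! i = int n)"
      using p pe by (auto simp: U_def)
    have len: "length xs = n" and dist: "distinct (map abs xs)" and abs: "abs ` set xs = {1..int n}"
      using xs(1) by (auto simp: signed_perms_def)
    have d: "distinct xs" using dist by (simp add: distinct_map)
    have "chain_neighbour p \<in> ?D \<and> chain_neighbour (chain_neighbour p) = p \<and> chain_neighbour p \<noteq> p"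
    proof (cases "Suc i < n")
      case True
      let ?ys = "xs[i := xs ! Suc i, Suc i := xs ! i]"
      have ms: "mset ?ys = mset xs" using True len
        by (metis Suc_lessD mset_swap)
      have ys: "?ys \<in> signed_perms n" "int n \<in> set ?ys"
      proof -
        have "mset (map abs ?ys) = mset (map abs xs)" using ms by simp
        then show "?ys \<in> signed_perms n" using len dist abs ms
          unfolding signed_perms_def mem_Collect_eq
          by (metis mset_eq_imp_distinct_iff mset_eq_setD length_list_update)
        show "int n \<in> set ?ys" using ms xs(2) by (metis mset_eq_setD)
      qed
      have "chain_labels l ?ys ({..<n} - {i}) = chain_labels l xs ({..<n} - {i})"
        unfolding chain_labels_def
        by (rule image_mset_cong, rule arg_cong[where f = l], rule set_take_swap) (use True len in auto)
      moreover have "chain_neighbour p = (?ys, i)" using True len pe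
        by (simp add: chain_neighbour_def)
      moreover have "chain_neighbour (?ys, i) = (xs, i)" using True len
        by (auto simp: chain_neighbour_def nth_list_update list_eq_iff_nth_eq)
      moreover have "?ys \<noteq> xs"
      proof
        assume "?ys = xs"
        then have "?ys ! i = xs ! i" by simp
        then have "xs ! Suc i = xs ! i" using True len by (simp add: nth_list_update)
        then show False using d True len by (simp add: nth_eq_iff_index_eq)
      qed
      ultimately show ?thesis using ys xs True pe by (auto simp: U_def)
    next
      case False
      then have i: "i = n - 1" "Suc i = n" using xs(3) by auto
      let ?ys = "xs[i := - (xs ! i)]"
      have ma: "map abs ?ys = map abs xs"
        by (simp add: map_update list_update_same_conv len xs(3))
      have ni: "xs ! i \<noteq> int n" using xs(5) i by simp
      obtain m where m: "m < n" "xs ! m = int n" using xs(2) len by (metis in_set_conv_nth)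
      have "m \<noteq> i" using m ni by auto
      then have mem: "int n \<in> set ?ys" using m len
        by (metis length_list_update nth_list_update_neq nth_mem)
      have nz: "xs ! i \<noteq> 0" using abs len xs(3)
        by (metis abs_0 atLeastAtMost_iff imageI not_one_le_zero nth_mem)
      have sp: "?ys \<in> signed_perms n" using ma len dist abs
        unfolding signed_perms_def mem_Collect_eq by (metis length_list_update set_map)
      have nn: "xs ! i \<noteq> - int n"
        using signed_perms_not_uminus[OF xs(1), of "int n"] xs(2,3) len by (metis nth_mem)
      have "chain_labels l ?ys ({..<n} - {i}) = chain_labels l xs ({..<n} - {i})"
        unfolding chain_labels_def
        by (rule image_mset_cong) (use i in \<open>auto simp: take_update_cancel\<close>)
      moreover have "chain_neighbour p = (?ys, i)" "chain_neighbour (?ys, i) = (xs, i)"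
        using False len pe xs(3) by (auto simp: chain_neighbour_def)
      moreover have "?ys \<noteq> xs" using nz len xs(3)
        by (metis neg_equal_zero nth_list_update_eq)
      ultimately show ?thesis using sp mem xs pe nn len by (auto simp: U_def)
    qed
    then show "chain_neighbour p \<in> ?D" "chain_neighbour (chain_neighbour p) = p"
      "chain_neighbour p \<noteq> p" by auto
  qed
  moreover have FQ: "card ?F = card ?Q"
  proof (rule sym, rule bij_betw_same_card)
    let ?g = "\<lambda>ys. (ys @ [int n], n - 1)"
    have sp: "ys @ [int n] \<in> signed_perms n \<longleftrightarrow> ys \<in> signed_perms (n - 1)" for ys
    proof -
      have eq: "{1..int n} = insert (int n) {1..int (n - 1)}" using assms(1) by auto
      have ni: "int n \<notin> {1..int (n - 1)}" using assms(1) by auto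
      show ?thesis
      proof
        assume *: "ys @ [int n] \<in> signed_perms n"
        then have "insert (int n) (abs ` set ys) = insert (int n) {1..int (n - 1)}"
          "int n \<notin> abs ` set ys"
          by (auto simp: signed_perms_def eq)
        then have "abs ` set ys = {1..int (n - 1)}" using ni by (metis insert_ident)
        with * show "ys \<in> signed_perms (n - 1)" by (auto simp: signed_perms_def)
      next
        assume "ys \<in> signed_perms (n - 1)"
        then show "ys @ [int n] \<in> signed_perms n" using ni assms(1) eq
          by (auto simp: signed_perms_def)
      qed
    qed
    have lab: "chain_labels l (ys @ [int n]) ({..<n} - {n - 1}) = chain_labels l ys {..<n - 1}"
      if "length ys = n - 1" for ys
    proof -
      have "{..<n} - {n - 1} = {..<n - 1}" by auto
      moreover have "take (Suc j) (ys @ [int n]) = take (Suc j) ys" if "j < n - 1" for j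
        using that \<open>length ys = n - 1\<close> by simp
      ultimately show ?thesis unfolding chain_labels_def
        by (metis (no_types, lifting) finite_lessThan elem_mset_set image_mset_cong lessThan_iff)
    qed
    have "?g ` ?Q = ?F"
    proof (intro equalityI subsetI)
      fix p assume "p \<in> ?g ` ?Q"
      then obtain ys where ys: "p = ?g ys" "ys \<in> ?Q" by blast
      then have "length ys = n - 1" by (auto simp: signed_perms_def)
      then show "p \<in> ?F" using ys sp[of ys] lab[of ys] assms(1)
        by (auto simp: U_def nth_append)
    next
      fix p assume "p \<in> ?F"
      then obtain xs where xs: "p = (xs, n - 1)" "xs \<in> signed_perms n" "xs ! (n - 1) = int n"
        "alternating_mset b (chain_labels l xs ({..<n} - {n - 1}))" by (auto simp: U_def)
      have len: "length xs = n" using xs(2) by (auto simp: signed_perms_def)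
      then have e: "xs = butlast xs @ [int n]" using assms(1) xs(3)
        by (metis append_butlast_last_id last_conv_nth length_greater_0_conv)
      then have "butlast xs \<in> ?Q" using xs sp[of "butlast xs"] lab[of "butlast xs"] len by auto
      then show "p \<in> ?g ` ?Q" using e xs(1) by blast
    qed
    then show "bij_betw ?g ?Q ?F" by (auto simp: bij_betw_def inj_on_def)
  qed
  have "card A = card (A - B) + card B" if "finite A" "B \<subseteq> A"
    for A B :: "(int list \<times> nat) set"
    using that by (metis card_Diff_subset card_mono finite_subset le_add_diff_inverse2)
  from this[OF fin, of ?F] have "card ?S = card ?D + card ?F" by (rule meta_mp) auto
  then show ?thesis using evenD FQ by presburger
qed

text \<open>Induction on the dimension. Summing the local count over the hemisphere shows that its
  chains alternating from either parity are together as many, modulo 2, as the alternating facets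
  counted in \<open>?S\<close>, an odd number by the equator. The antipodal map carries the chains
  of the wrong starting parity to the right ones in the other hemisphere.\<close>

lemma odd_card_alternating_chains:
  assumes "tucker_labelling n l"
  shows "odd (card {xs \<in> signed_perms n. alternating_mset True (chain_labels l xs {..<n})})"
  using assms
proof (induction n)
  case 0
  have "{xs \<in> signed_perms 0. alternating_mset True (chain_labels l xs {..<0})} = {[]}"
    by (auto simp: signed_perms_def chain_labels_def alternating_mset_def)
  then show ?case by simp
next
  case (Suc n)
  let ?N = "Suc n"
  let ?U = "{xs \<in> signed_perms ?N. int ?N \<in> set xs}"
  let ?alt = "\<lambda>b xs. alternating_mset b (chain_labels l xs {..<?N})"
  let ?S = "{(xs, i). xs \<in> ?U \<and> i < ?N \<and> alternating_mset True (chain_labels l xs ({..<?N} - {i}))}"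
  have finU: "finite ?U" using finite_signed_perms by simp
  have "odd (card ?S)"
    using card_facets[of ?N True l] Suc.IH[OF tucker_labelling_mono[OF Suc.prems]] by auto
  moreover have "card ?S = (\<Sum>xs\<in>?U. \<Sum>i<?N. of_bool (alternating_mset True (chain_labels l xs ({..<?N} - {i}))))"
  proof -
    have "?S = Sigma ?U (\<lambda>xs. {i \<in> {..<?N}. alternating_mset True (chain_labels l xs ({..<?N} - {i}))})"
      by auto
    also have "card \<dots> = (\<Sum>xs\<in>?U. card {i \<in> {..<?N}. alternating_mset True (chain_labels l xs ({..<?N} - {i}))})"
      by (rule card_SigmaI) (use finU in auto)
    finally show ?thesis by (simp only: sum_of_bool_card finite_lessThan)
  qed
  moreover have "even ((\<Sum>i<?N. of_bool (alternating_mset True (chain_labels l xs ({..<?N} - {i}))))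
      + of_bool (?alt True xs) + (of_bool (?alt False xs) :: nat))" for xs
  proof -
    let ?M = "chain_labels l xs {..<?N}"
    let ?f = "\<lambda>j. l (set (take (Suc j) xs))"
    have "chain_labels l xs ({..<?N} - {i}) = ?M - {#?f i#}" if "i < ?N" for i
    proof -
      have "mset_set {..<?N} = add_mset i (mset_set ({..<?N} - {i}))"
        using that by (metis finite_lessThan lessThan_iff mset_set.remove)
      then show ?thesis by (simp add: chain_labels_def)
    qed
    then have "(\<Sum>i<?N. of_bool (alternating_mset True (chain_labels l xs ({..<?N} - {i}))) :: nat)
      = (\<Sum>x\<in>#?M. of_bool (alternating_mset True (?M - {#x#})))"
      unfolding chain_labels_def[of l xs "{..<?N}"]
      by (simp add: multiset.map_comp o_def sum_unfold_sum_mset cong: sum.cong)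
        (intro arg_cong[where f = sum_mset] image_mset_cong, auto simp: chain_labels_def)
    then show ?thesis using sum_alternating_mset_diff[of True ?M] by simp
  qed
  then have "even (\<Sum>xs\<in>?U. (\<Sum>i<?N. of_bool (alternating_mset True (chain_labels l xs ({..<?N} - {i}))))
      + of_bool (?alt True xs) + (of_bool (?alt False xs) :: nat))"
    by (intro dvd_sum) auto
  ultimately have "odd ((\<Sum>xs\<in>?U. of_bool (?alt True xs) :: nat) + (\<Sum>xs\<in>?U. of_bool (?alt False xs)))"
    by (simp only: sum.distrib even_add) blast
  moreover have "(\<Sum>xs\<in>?U. of_bool (?alt b xs) :: nat) = card {xs \<in> ?U. ?alt b xs}" for b
    by (rule sum_of_bool_card[OF finU])
  moreover have "card {xs \<in> ?U. ?alt False xs}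
      = card {xs \<in> signed_perms ?N. int ?N \<notin> set xs \<and> ?alt True xs}"
  proof (rule bij_betw_same_card)
    have m: "int ?N \<in> set (map uminus xs) \<longleftrightarrow> int ?N \<notin> set xs" if "xs \<in> signed_perms ?N" for xs
    proof -
      have "int ?N \<in> set (map uminus xs) \<longleftrightarrow> - int ?N \<in> set xs"
        unfolding set_map image_iff by (metis add.inverse_inverse)
      then show ?thesis using signed_perms_mem_iff[OF that] by blast
    qed
    show "bij_betw (map uminus) {xs \<in> ?U. ?alt False xs}
        {xs \<in> signed_perms ?N. int ?N \<notin> set xs \<and> ?alt True xs}"
      by (rule bij_betw_byWitness[where f' = "map uminus"])
        (use m alternating_chain_uminus[OF Suc.prems] uminus_signed_perms in \<open>auto simp: o_def simp del: set_map\<close>)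
  qed
  moreover have "card {xs \<in> signed_perms ?N. ?alt True xs} =
      card {xs \<in> ?U. ?alt True xs} + card {xs \<in> signed_perms ?N. int ?N \<notin> set xs \<and> ?alt True xs}"
    using finite_signed_perms by (subst card_Un_disjoint[symmetric]) (auto intro: arg_cong[where f = card])
  ultimately show ?case by simp
qed

text \<open>An alternating chain carries \<open>n\<close> distinct labels. No two of them are
  opposite, so they lie in \<open>n\<close> different pairs among the \<open>m\<close>
  available.\<close>

theorem octahedral_tucker:
  assumes "tucker_labelling n l" and "\<And>X. X \<in> sign_vectors n \<Longrightarrow> l X < 2 * m"
  shows "n \<le> m"
proof -
  have "{xs \<in> signed_perms n. alternating_mset True (chain_labels l xs {..<n})} \<noteq> {}"
    using odd_card_alternating_chains[OF assms(1)] by (metis card.empty even_zero)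
  then obtain xs where xs: "xs \<in> signed_perms n"
    and alt: "alternating_mset True (chain_labels l xs {..<n})" by blast
  let ?f = "\<lambda>j. l (set (take (Suc j) xs))"
  have "distinct (sorted_list_of_multiset (chain_labels l xs {..<n}))"
    using alternating_sorted_distinct alt sorted_sorted_list_of_multiset
    unfolding alternating_mset_def by blast
  moreover have "mset (map ?f [0..<n]) = chain_labels l xs {..<n}"
    by (simp add: chain_labels_def lessThan_atLeast0)
  ultimately have "distinct (map ?f [0..<n])"
    by (metis distinct_sort sorted_list_of_multiset_mset)
  then have inj: "inj_on ?f {..<n}" by (simp add: distinct_map lessThan_atLeast0)
  have "inj_on (\<lambda>j. ?f j div 2) {..<n}"
  proof
    fix i j assume ij: "i \<in> {..<n}" "j \<in> {..<n}" "?f i div 2 = ?f j div 2"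
    have "?f j \<noteq> flip (?f i)"
      by (rule chain_labels_no_flip[OF assms(1) xs]) (use ij in \<open>auto simp: chain_labels_def\<close>)
    then show "i = j" using div2_eq_cases[OF ij(3)] inj ij by (auto dest: inj_onD)
  qed
  moreover have "(\<lambda>j. ?f j div 2) ` {..<n} \<subseteq> {..<m}"
    using assms(2) take_sign_vectors[OF xs] by (auto simp: less_mult_imp_div_less mult.commute)
  ultimately show ?thesis by (metis card_inj_on_le card_lessThan finite_lessThan)
qed

section \<open>Colourings of the cube\<close>

text \<open>Coordinates of the cube start at \<open>0\<close>, which has no sign; hence the shift by
  one. The negative part of \<open>X\<close> is the positive part of its antipode.\<close>

definition positives :: "nat \<Rightarrow> int set \<Rightarrow> nat set" where
  "positives d X = {i. i < d \<and> int i + 1 \<in> X}"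

lemma card_positives_union:
  assumes "X \<in> sign_vectors d"
  shows "card (positives d X \<union> positives d (uminus ` X)) = card X"
proof -
  have X: "1 \<le> \<bar>x\<bar>" "\<bar>x\<bar> \<le> int d" "- x \<notin> X" if "x \<in> X" for x
  proof -
    have "\<bar>x\<bar> \<in> {1..int d}" using assms that by (auto simp: sign_vectors_def)
    then show "1 \<le> \<bar>x\<bar>" "\<bar>x\<bar> \<le> int d" by auto
    show "- x \<notin> X" using assms that by (force simp: sign_vectors_def)
  qed
  have "positives d X \<union> positives d (uminus ` X) = (\<lambda>x. nat (\<bar>x\<bar> - 1)) ` X" (is "?L = ?R")
  proof (intro equalityI subsetI)
    fix i assume "i \<in> ?L"
    then have "int i + 1 \<in> X \<or> int i + 1 \<in> uminus ` X" by (auto simp: positives_def)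
    then have "int i + 1 \<in> X \<or> - (int i + 1) \<in> X" by (metis add.inverse_inverse imageE)
    then show "i \<in> ?R"
    proof
      assume "int i + 1 \<in> X" then show ?thesis by (rule rev_image_eqI) simp
    next
      assume "- (int i + 1) \<in> X" then show ?thesis by (rule rev_image_eqI) simp
    qed
  next
    fix i assume "i \<in> ?R"
    then obtain x where x: "x \<in> X" "i = nat (\<bar>x\<bar> - 1)" by blast
    then have "int i + 1 = x \<or> int i + 1 = - x" "i < d" using X[OF x(1)] by auto
    then show "i \<in> ?L" using x(1) by (auto simp: positives_def)
  qed
  moreover have "inj_on (\<lambda>x. nat (\<bar>x\<bar> - 1)) X"
  proof
    fix x y assume xy: "x \<in> X" "y \<in> X" "nat (\<bar>x\<bar> - 1) = nat (\<bar>y\<bar> - 1)"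
    then have "x = y \<or> x = - y" using X(1)[OF xy(1)] X(1)[OF xy(2)] by linarith
    then show "x = y" using X(3) xy by auto
  qed
  ultimately show ?thesis by (simp add: card_image)
qed

lemma uminus_sign_vectors: "uminus ` X \<in> sign_vectors d \<longleftrightarrow> X \<in> sign_vectors d"
  by (auto simp: sign_vectors_def image_image)

text \<open>Since \<open>Y\<close> extends \<open>X\<close>, the positive parts of \<open>X\<close>
  and of the antipode of \<open>Y\<close> disagree at every index in the support of
  \<open>X\<close>.\<close>

lemma card_sym_diff_positives:
  assumes "X \<in> sign_vectors d" "Y \<in> sign_vectors d" "X \<subseteq> Y"
  shows "card X \<le> card (sym_diff (positives d X) (positives d (uminus ` Y)))"
proof -
  have "positives d X \<inter> positives d (uminus ` Y) = {}"
    using assms(2,3) by (auto simp: positives_def sign_vectors_def)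
  moreover have "positives d (uminus ` X) \<subseteq> positives d (uminus ` Y)"
    using assms(3) by (auto simp: positives_def)
  ultimately have "positives d X \<union> positives d (uminus ` X)
      \<subseteq> sym_diff (positives d X) (positives d (uminus ` Y))" by blast
  moreover have "finite (sym_diff (positives d X) (positives d (uminus ` Y)))"
    by (simp add: positives_def)
  ultimately show ?thesis using card_positives_union[OF assms(1)] by (metis card_mono)
qed

text \<open>Sign vectors of small support are labelled by the size of the support, the others by the smaller
  of the colours of their positive and of their negative part. Without a far monochromatic pair this
  would be a Tucker labelling with only \<open>d - 1\<close> labels.\<close>

lemma cube_coloring_far_pair:
  fixes c :: "nat set \<Rightarrow> nat"
  assumes col: "\<And>v. v \<subseteq> {..<d} \<Longrightarrow> c v < k" and kd: "k \<le> d"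
  shows "\<exists>v w. v \<subseteq> {..<d} \<and> w \<subseteq> {..<d} \<and> c v = c w \<and> d - k < card (sym_diff v w)"
proof (rule ccontr)
  assume "\<not> ?thesis"
  then have far: "c v \<noteq> c w" if "v \<subseteq> {..<d}" "w \<subseteq> {..<d}" "d - k < card (sym_diff v w)" for v w
    using that by blast
  have kpos: "0 < k" using col[of "{}"] by simp
  define p where "p = positives d"
  define q where "q X = p (uminus ` X)" for X
  have pq: "p X \<subseteq> {..<d}" "q X \<subseteq> {..<d}" for X by (auto simp: p_def q_def positives_def)
  have uu: "uminus ` uminus ` X = X" for X :: "int set" by (simp add: image_image)
  have qu: "q (uminus ` X) = p X" "p (uminus ` X) = q X" for X by (simp_all add: q_def uu)
  \<comment> \<open>For small supports the sign of the label has to change under the antipodal map;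
    the sign at the largest index of the support serves for this.\<close>
  define top where "top X \<longleftrightarrow> Max (abs ` X) \<in> X" for X :: "int set"
  define sg where "sg b = (if b then 0 else 1 :: nat)" for b
  define l where "l X = (if card X \<le> d - k then 2 * (card X - 1) + sg (top X)
     else 2 * (d - k + min (c (p X)) (c (q X))) + sg (c (p X) < c (q X)))" for X
  have fin: "finite X" if "X \<in> sign_vectors d" for X
  proof (rule finite_subset)
    show "X \<subseteq> {- int d..int d}"
    proof
      fix x assume "x \<in> X"
      then have "\<bar>x\<bar> \<in> {1..int d}" using that by (auto simp: sign_vectors_def)
      then show "x \<in> {- int d..int d}" by auto
    qed
  qed simp
  have card_u: "card (uminus ` X) = card X" for X :: "int set" by (simp add: card_image)
  have cpos: "card X > 0" if "X \<in> sign_vectors d" for X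
    using fin[OF that] that by (auto simp: sign_vectors_def card_gt_0_iff)
  have top_u: "top (uminus ` X) \<longleftrightarrow> \<not> top X" if X: "X \<in> sign_vectors d" for X
  proof -
    let ?m = "Max (abs ` X)"
    have "?m \<in> abs ` X" using fin[OF X] X by (intro Max_in) (auto simp: sign_vectors_def)
    then have "?m \<in> X \<or> - ?m \<in> X" by (metis abs_if add.inverse_inverse imageE)
    moreover have "\<not> (?m \<in> X \<and> - ?m \<in> X)"
      using X unfolding sign_vectors_def by (auto simp: image_iff disjoint_iff) 
    moreover have "?m \<in> uminus ` X \<longleftrightarrow> - ?m \<in> X" by (metis add.inverse_inverse imageE imageI)
    ultimately show ?thesis by (auto simp: top_def image_image)
  qed
  have neq: "c (p X) \<noteq> c (q Y)" if "X \<in> sign_vectors d" "Y \<in> sign_vectors d" "X \<subseteq> Y" "\<not> card X \<le> d - k" for X Y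
    using card_sym_diff_positives[OF that(1-3)] that(4) far[of "p X" "q Y"] pq
    by (simp add: p_def q_def)
  have flip_sg: "flip (2 * a + sg b) = 2 * a + sg (\<not> b)" for a b
    by (auto simp: flip_def sg_def)
  have inj_sg: "2 * a + sg b = 2 * a' + sg b' \<longleftrightarrow> a = a' \<and> b = b'" for a a' b b'
    by (auto simp: sg_def split: if_splits) presburger+
  have "tucker_labelling d l"
    unfolding tucker_labelling_def
  proof (intro conjI ballI impI)
    fix X assume X: "X \<in> sign_vectors d"
    show "l (uminus ` X) = flip (l X)"
    proof (cases "card X \<le> d - k")
      case True
      then show ?thesis using top_u[OF X] by (simp add: l_def card_u flip_sg)
    next
      case False
      then have "c (p X) \<noteq> c (q X)" using neq[OF X X] by simp
      then have "c (q X) < c (p X) \<longleftrightarrow> \<not> c (p X) < c (q X)" by auto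
      with False show ?thesis by (simp only: l_def card_u flip_sg qu min.commute[of "c (q X)"] if_False)
    qed
  next
    fix X Y assume XY: "X \<in> sign_vectors d" "Y \<in> sign_vectors d" "X \<subseteq> Y"
    show "l Y \<noteq> flip (l X)"
    proof
      assume eq: "l Y = flip (l X)"
      have le: "card X \<le> card Y" using XY fin by (simp add: card_mono)
      consider "card Y \<le> d - k" | "card X \<le> d - k" "\<not> card Y \<le> d - k" | "\<not> card X \<le> d - k" by blast
      then show False
      proof cases
        case 1
        then have "card Y - 1 = card X - 1" using eq le by (simp add: l_def flip_sg inj_sg)
        then have "card Y = card X" using cpos[OF XY(1)] cpos[OF XY(2)] by simp
        then have "X = Y" using XY fin by (metis card_subset_eq)
        then show False using eq flip_simps(4) by metis
      next
        case 2
        then have "2 * (d - k + min (c (p Y)) (c (q Y))) + sg (c (p Y) < c (q Y))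
            = 2 * (card X - 1) + sg (\<not> top X)"
          using eq by (simp only: l_def flip_sg if_True if_False)
        then have "card X - 1 = d - k + min (c (p Y)) (c (q Y))"
          unfolding inj_sg by simp
        then show False using 2 cpos[OF XY(1)] by linarith
      next
        case 3
        then have Y: "\<not> card Y \<le> d - k" using le by linarith
        have *: "min (c (p Y)) (c (q Y)) = min (c (p X)) (c (q X))"
          "c (p Y) < c (q Y) \<longleftrightarrow> \<not> c (p X) < c (q X)"
        proof -
          have "2 * (d - k + min (c (p Y)) (c (q Y))) + sg (c (p Y) < c (q Y))
            = 2 * (d - k + min (c (p X)) (c (q X))) + sg (\<not> c (p X) < c (q X))"
            using eq 3 Y by (simp only: l_def flip_sg if_False)
          then show "min (c (p Y)) (c (q Y)) = min (c (p X)) (c (q X))"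
            "c (p Y) < c (q Y) \<longleftrightarrow> \<not> c (p X) < c (q X)"
            unfolding inj_sg by simp_all
        qed
        \<comment> \<open>With equal minima and opposite comparisons, the smaller colours sit at
          \<open>p X\<close> and \<open>q Y\<close>, or at \<open>q X\<close> and
          \<open>p Y\<close>. Both are far pairs and cannot share a colour.\<close>
        have "c (p X) \<noteq> c (q Y)" using neq[OF XY] 3 by simp
        moreover have "c (q X) \<noteq> c (p Y)"
          using neq[of "uminus ` X" "uminus ` Y"] XY 3 by (auto simp: uminus_sign_vectors card_u qu)
        ultimately show False using * by (auto simp: min_def split: if_splits)
      qed
    qed
  qed
  \<comment> \<open>Small supports use the pair indices below \<open>d - k\<close>. For the others,
    the smaller of two different colours below \<open>k\<close> is less than \<open>k - 1\<close>,
    so all indices stay below \<open>d - 1\<close>.\<close>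
  moreover have "l X < 2 * (d - 1)" if X: "X \<in> sign_vectors d" for X
  proof (cases "card X \<le> d - k")
    case True
    then show ?thesis using cpos[OF X] kpos by (auto simp: l_def sg_def)
  next
    case False
    then have "c (p X) \<noteq> c (q X)" using neq[OF X X] by simp
    moreover have "c (p X) < k" "c (q X) < k" using col pq by auto
    ultimately have "min (c (p X)) (c (q X)) < k - 1" by (auto simp: min_def)
    then show ?thesis using False kd by (auto simp: l_def sg_def)
  qed
  ultimately have "d \<le> d - 1" by (rule octahedral_tucker)
  then show False using kd kpos by simp
qed

section \<open>Bits of a rotation\<close>

text \<open>The squared form of the bound \<open>4 ^ m / sqrt (2 * m + 1)\<close>, which suits
  induction: the step reduces to (2m + 1)(2m + 3) \<le> (2m + 2)^2.\<close>

lemma central_binomial_sq_le: "real ((2 * m) choose m) ^ 2 * (2 * real m + 1) \<le> 16 ^ m"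
proof (induction m)
  case (Suc m)
  let ?b = "real ((2 * m) choose m)" and ?b' = "real ((2 * Suc m) choose Suc m)"
  have rec: "(real m + 1) * ?b' = 2 * (2 * real m + 1) * ?b"
  proof -
    let ?c = "(2 * m + 1) choose m"
    have "Suc m * ((2 * Suc m) choose Suc m) = Suc (2 * m + 1) * ?c"
      using Suc_times_binomial[of m "2 * m + 1"] by simp
    also have "\<dots> = 2 * (Suc m * ?c)" by simp
    also have "?c = Suc (2 * m) choose Suc m"
      by (subst binomial_symmetric) auto
    also have "Suc m * (Suc (2 * m) choose Suc m) = Suc (2 * m) * ((2 * m) choose m)"
      by (rule Suc_times_binomial)
    finally have "real (Suc m * ((2 * Suc m) choose Suc m)) = real (2 * (Suc (2 * m) * ((2 * m) choose m)))"
      by (rule arg_cong)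
    then show ?thesis by (simp only: of_nat_mult of_nat_Suc of_nat_numeral mult.assoc) (simp add: algebra_simps)
  qed
  have "(real m + 1)\<^sup>2 * (?b'\<^sup>2 * (2 * real m + 3)) = ((real m + 1) * ?b')\<^sup>2 * (2 * real m + 3)"
    by (simp add: power_mult_distrib)
  also have "\<dots> = 4 * (?b\<^sup>2 * (2 * real m + 1)) * ((2 * real m + 1) * (2 * real m + 3))"
    unfolding rec by (simp add: power2_eq_square algebra_simps)
  also have "\<dots> \<le> 4 * 16 ^ m * (4 * (real m + 1)\<^sup>2)"
  proof (rule mult_mono)
    show "4 * (?b\<^sup>2 * (2 * real m + 1)) \<le> 4 * 16 ^ m" using Suc.IH by simp
    show "(2 * real m + 1) * (2 * real m + 3) \<le> 4 * (real m + 1)\<^sup>2"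
      by (simp add: power2_eq_square algebra_simps)
  qed auto
  also have "\<dots> = (real m + 1)\<^sup>2 * 16 ^ Suc m" by simp
  finally have "(real m + 1)\<^sup>2 * (?b'\<^sup>2 * (2 * real m + 3)) \<le> (real m + 1)\<^sup>2 * 16 ^ Suc m" .
  then have "?b'\<^sup>2 * (2 * real m + 3) \<le> 16 ^ Suc m"
    by (rule mult_left_le_imp_le) (simp add: power2_eq_square add_pos_nonneg)
  then show ?case by (simp add: algebra_simps)
qed simp

lemma central_binomial_small:
  fixes e :: real
  assumes "e > 0"
  shows "\<exists>m\<ge>k. real ((2 * m) choose m) \<le> e * 4 ^ m"
proof -
  obtain n :: nat where n: "1 / e\<^sup>2 < real n" using reals_Archimedean2 by blast
  define m where "m = max k n"
  have "1 / e\<^sup>2 \<le> 2 * real m + 1" using n by (simp add: m_def)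
  then have e: "1 \<le> e\<^sup>2 * (2 * real m + 1)" using assms by (simp add: field_simps)
  let ?b = "real ((2 * m) choose m)"
  have "?b\<^sup>2 \<le> ?b\<^sup>2 * (e\<^sup>2 * (2 * real m + 1))" using e by (simp add: mult_le_cancel_left1)
  also have "\<dots> = e\<^sup>2 * (?b\<^sup>2 * (2 * real m + 1))" by simp
  also have "\<dots> \<le> e\<^sup>2 * 16 ^ m" using central_binomial_sq_le by (simp add: mult_left_mono)
  also have "\<dots> = (e * 4 ^ m)\<^sup>2"
    using power_mult_distrib[of "4::real" 4 m] by (simp add: power2_eq_square algebra_simps)
  finally have "?b \<le> e * 4 ^ m" by (rule power2_le_imp_le) (use assms in simp)
  moreover have "k \<le> m" by (simp add: m_def)
  ultimately show ?thesis by blast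
qed

text \<open>The unsafe points form a half-open arc of length \<open>1 / M\<close> around the
  integers. Being half-open, it contains at most one of the \<open>M\<close> translates of a point
  by multiples of \<open>1 / M\<close>.\<close>

definition frac_safe :: "nat \<Rightarrow> real \<Rightarrow> bool" where
  "frac_safe M x \<longleftrightarrow> frac x \<in> {1 / (2 * real M)..<1 - 1 / (2 * real M)}"

lemma floor_add_frac_safe:
  assumes "frac_safe M x" "\<bar>y - of_int z\<bar> < 1 / (2 * real M)"
  shows "\<lfloor>x + y\<rfloor> = \<lfloor>x\<rfloor> + z"
proof -
  have "x = of_int \<lfloor>x\<rfloor> + frac x" by (simp add: frac_def)
  then show ?thesis using assms unfolding frac_safe_def by (intro floor_unique) auto
qed

lemma card_not_frac_safe_le_1:
  assumes "M > 0"
  shows "card {s. s < M \<and> \<not> frac_safe M (x + real s / real M)} \<le> 1"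
proof -
  let ?h = "1 / (2 * real M)"
  have h: "?h > 0" "2 * ?h = 1 / real M" using assms by auto
  have near: "\<exists>z::int. - ?h \<le> y - z \<and> y - z < ?h" if "\<not> frac_safe M y" for y
  proof (cases "frac y < ?h")
    case True
    then show ?thesis using h frac_ge_0[of y] unfolding frac_def
      by (intro exI[of _ "\<lfloor>y\<rfloor>"]) linarith
  next
    case False
    then have "frac y \<ge> 1 - ?h" "frac y < 1" using that by (auto simp: frac_safe_def frac_lt_1)
    then show ?thesis using h by (intro exI[of _ "\<lfloor>y\<rfloor> + 1"]) (simp add: frac_def)
  qed
  have False if st: "s < t" "t < M" and bad: "\<not> frac_safe M (x + real s / real M)"
    "\<not> frac_safe M (x + real t / real M)" for s t
  proof -
    obtain z where z: "- ?h \<le> x + real s / real M - of_int z" "x + real s / real M - of_int z < ?h"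
      using near[OF bad(1)] by blast
    obtain w where w: "- ?h \<le> x + real t / real M - of_int w" "x + real t / real M - of_int w < ?h"
      using near[OF bad(2)] by blast
    have "\<bar>real t / real M - real s / real M - of_int (w - z)\<bar> < 1 / real M"
      using z w h(2) by (simp add: abs_less_iff)
    then have "\<bar>real t / real M - real s / real M - of_int (w - z)\<bar> * real M < 1"
      using assms by (simp add: field_simps)
    moreover have "\<bar>real t / real M - real s / real M - of_int (w - z)\<bar> * real M
        = \<bar>(real t / real M - real s / real M - of_int (w - z)) * real M\<bar>"
      by (simp add: abs_mult)
    moreover have "(real t / real M - real s / real M - of_int (w - z)) * real M
        = of_int (int t - int s - (w - z) * int M)"
      using assms by (simp add: field_simps)
    ultimately have "\<bar>real_of_int (int t - int s - (w - z) * int M)\<bar> < 1" by simp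
    then have "\<bar>int t - int s - (w - z) * int M\<bar> < 1" by linarith
    then have e: "int t - int s = (w - z) * int M" by simp
    have "0 < (w - z) * int M" "(w - z) * int M < 1 * int M" using st unfolding e[symmetric] by auto
    then have "0 < w - z" "w - z < 1"
      using assms by (auto simp: zero_less_mult_iff mult_less_cancel_right)
    then show False by simp
  qed
  then have "s = t" if "s \<in> {s. s < M \<and> \<not> frac_safe M (x + real s / real M)}"
    "t \<in> {s. s < M \<and> \<not> frac_safe M (x + real s / real M)}" for s t
    using that by (cases s t rule: linorder_cases) auto
  then show ?thesis unfolding One_nat_def by (subst card_le_Suc0_iff_eq) auto
qed

section \<open>Bits and majorities under addition\<close>

text \<open>A shift \<open>t = (u, s)\<close> translates the torus by \<open>s / M\<close> in every coordinate and then flips the bits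
  in \<open>u\<close>. The bit of \<open>n\<close> at coordinate \<open>i\<close> is the parity of the integer part. A number is bad if
  some bit is unstable under perturbations of size \<open>1 / (2 * M)\<close>, or if the majority of the bits can
  be changed by \<open>k\<close> of them.\<close>

definition ones :: "nat \<Rightarrow> nat \<Rightarrow> (nat \<Rightarrow> real) \<Rightarrow> nat set \<times> nat \<Rightarrow> nat \<Rightarrow> nat set" where
  "ones d M a t n = {i. i < d \<and> (odd \<lfloor>real n * a i + real (snd t) / real M\<rfloor> \<noteq> (i \<in> fst t))}"

definition majority :: "nat \<Rightarrow> nat \<Rightarrow> (nat \<Rightarrow> real) \<Rightarrow> nat set \<times> nat \<Rightarrow> nat \<Rightarrow> bool" where
  "majority d M a t n \<longleftrightarrow> d < 2 * card (ones d M a t n)"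

definition bad :: "nat \<Rightarrow> nat \<Rightarrow> nat \<Rightarrow> (nat \<Rightarrow> real) \<Rightarrow> nat set \<times> nat \<Rightarrow> nat \<Rightarrow> bool" where
  "bad k d M a t n \<longleftrightarrow> (\<exists>i<d. \<not> frac_safe M (real n * a i + real (snd t) / real M)) \<or>
     \<bar>2 * int (card (ones d M a t n)) - int d\<bar> \<le> 2 * int k"

definition near_even :: "nat \<Rightarrow> real \<Rightarrow> bool" where
  "near_even M x \<longleftrightarrow> (\<exists>z::int. even z \<and> \<bar>x - of_int z\<bar> < 1 / (2 * real M))"

definition near_odd :: "nat \<Rightarrow> real \<Rightarrow> bool" where
  "near_odd M x \<longleftrightarrow> (\<exists>z::int. odd z \<and> \<bar>x - of_int z\<bar> < 1 / (2 * real M))"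

lemma parity_floor_near:
  assumes "frac_safe M x"
  shows "near_even M y \<Longrightarrow> odd \<lfloor>x + y\<rfloor> = odd \<lfloor>x\<rfloor>" and "near_odd M y \<Longrightarrow> odd \<lfloor>x + y\<rfloor> = even \<lfloor>x\<rfloor>"
  using floor_add_frac_safe[OF assms] by (auto simp: near_even_def near_odd_def)

lemma ones_add:
  assumes "\<not> bad k d M a t n"
    and "\<And>i. i < d \<Longrightarrow> near_even M (real r * a i) \<or> near_odd M (real r * a i)"
  shows "ones d M a t (n + r) = sym_diff (ones d M a t n) {i. i < d \<and> near_odd M (real r * a i)}"
proof -
  have "odd \<lfloor>real (n + r) * a i + real (snd t) / real M\<rfloor>
    \<longleftrightarrow> (odd \<lfloor>real n * a i + real (snd t) / real M\<rfloor> \<noteq> near_odd M (real r * a i))" if "i < d" for i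
  proof -
    let ?x = "real n * a i + real (snd t) / real M"
    have e: "real (n + r) * a i + real (snd t) / real M = ?x + real r * a i"
      by (simp add: algebra_simps)
    have "frac_safe M ?x" using assms(1) that by (auto simp: bad_def)
    from parity_floor_near[OF this, of "real r * a i"] show ?thesis
      unfolding e using assms(2)[OF that] by blast
  qed
  then show ?thesis unfolding ones_def by auto
qed

lemma majority_add_near_even:
  assumes "\<not> bad k d M a t n" "\<not> bad k d M a t (n + r)" and "\<And>i. i < d \<Longrightarrow> near_even M (real r * a i)"
  shows "majority d M a t (n + r) = majority d M a t n"
proof -
  have "odd \<lfloor>real (n + r) * a i + real (snd t) / real M\<rfloor>
    \<longleftrightarrow> odd \<lfloor>real n * a i + real (snd t) / real M\<rfloor>" if "i < d" for i
  proof -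
    let ?x = "real n * a i + real (snd t) / real M"
    have e: "real (n + r) * a i + real (snd t) / real M = ?x + real r * a i"
      by (simp add: algebra_simps)
    have "frac_safe M ?x" using assms(1) that by (auto simp: bad_def)
    from parity_floor_near(1)[OF this assms(3)[OF that]] show ?thesis unfolding e .
  qed
  then have "ones d M a t (n + r) = ones d M a t n" unfolding ones_def by auto
  then show ?thesis by (simp add: majority_def)
qed

text \<open>All but at most \<open>k\<close> bits flip, so the numbers of ones before and after add
  up to \<open>d\<close> within an error of \<open>k\<close>. Each of them is more than
  \<open>k\<close> away from \<open>d / 2\<close>, hence they lie on different sides.\<close>

lemma majority_add_near_odd:
  assumes "\<not> bad k d M a t n" "\<not> bad k d M a t (n + r)"
    and "\<And>i. i < d \<Longrightarrow> near_even M (real r * a i) \<or> near_odd M (real r * a i)"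
    and "d \<le> card {i. i < d \<and> near_odd M (real r * a i)} + k"
  shows "majority d M a t (n + r) \<noteq> majority d M a t n"
proof -
  let ?W = "{i. i < d \<and> near_odd M (real r * a i)}" and ?B = "ones d M a t n"
  let ?C = "sym_diff ?B ?W"
  have sub: "?B \<subseteq> {..<d}" "?W \<subseteq> {..<d}" by (auto simp: ones_def)
  then have fin: "finite ?B" "finite ?W" by (auto intro: finite_subset)
  have "card ?W \<le> card (?C \<union> ?B)" by (rule card_mono) (use fin in auto)
  also have "\<dots> \<le> card ?C + card ?B" by (rule card_Un_le)
  finally have lo: "card ?W \<le> card ?C + card ?B" .
  have "card ?C = card (?B - ?W) + card (?W - ?B)" by (rule card_Un_disjoint) (use fin in auto)
  moreover have "card (?W - ?B) + card ?B = card (?W \<union> ?B)"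
    using card_Un_disjoint[of "?W - ?B" ?B] fin by (simp add: Un_Diff_cancel2 Int_commute)
  moreover have "card (?W \<union> ?B) \<le> d" using card_mono[of "{..<d}" "?W \<union> ?B"] sub by simp
  moreover have "card (?B - ?W) \<le> card ({..<d} - ?W)" by (rule card_mono) (use sub in auto)
  moreover have "card ({..<d} - ?W) = d - card ?W"
    using sub fin by (simp add: card_Diff_subset)
  ultimately have hi: "card ?C + card ?B \<le> d + k" using assms(4) by linarith
  have "ones d M a t (n + r) = ?C" by (rule ones_add[OF assms(1,3)])
  then have "\<bar>2 * int (card ?C) - int d\<bar> > 2 * int k" "\<bar>2 * int (card ?B) - int d\<bar> > 2 * int k"
    "majority d M a t (n + r) \<longleftrightarrow> d < 2 * card ?C" "majority d M a t n \<longleftrightarrow> d < 2 * card ?B"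
    using assms(1,2) by (auto simp: bad_def majority_def)
  then show ?thesis using lo hi assms(4) by linarith
qed

text \<open>At \<open>0\<close> every coordinate equals the grid point \<open>snd t / M\<close>. If
  it is safe, it is at least \<open>1 / M\<close> away from the integers, and a movement by less
  than \<open>1 / (2 * M)\<close> changes neither safety nor integer part.\<close>

lemma not_bad_small:
  assumes "\<not> bad k d M a t 0" "snd t < M" and "\<And>i. i < d \<Longrightarrow> 0 \<le> a i \<and> real n * a i < 1 / (2 * real M)"
  shows "\<not> bad k d M a t n"
proof -
  let ?s = "real (snd t) / real M"
  have M: "M > 0" using assms(2) by auto
  have f0: "frac ?s = ?s" using assms(2) by (simp add: frac_eq)
  have *: "frac_safe M (real n * a i + ?s) \<and> \<lfloor>real n * a i + ?s\<rfloor> = \<lfloor>?s\<rfloor>" if "i < d" for i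
  proof -
    have s0: "frac_safe M ?s" using assms(1) that by (auto simp: bad_def)
    then have "1 / (2 * real M) \<le> ?s" by (simp add: frac_safe_def f0)
    then have "snd t \<noteq> 0" using M by (intro notI) simp
    then have s: "1 / real M \<le> ?s" "?s \<le> 1 - 1 / real M" using assms(2) M
      by (auto simp: field_simps)
    let ?y = "real n * a i"
    have y: "0 \<le> ?y" "?y < 1 / (2 * real M)" using assms(3)[OF that] by auto
    have h: "1 / real M = 2 * (1 / (2 * real M))" "0 < 1 / (2 * real M)" using M by auto
    have "?y + ?s < 1" "0 \<le> ?y + ?s" using s y h by linarith+
    then have "frac (?y + ?s) = ?y + ?s" "\<lfloor>?y + ?s\<rfloor> = 0" by (simp_all add: frac_eq floor_eq_iff)
    moreover have "\<lfloor>?s\<rfloor> = 0" using s h unfolding floor_eq_iff of_int_0 by linarith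
    moreover have "1 / (2 * real M) \<le> ?y + ?s" "?y + ?s < 1 - 1 / (2 * real M)"
      using s y h by linarith+
    ultimately show ?thesis by (simp add: frac_safe_def)
  qed
  then have "ones d M a t n = ones d M a t 0" by (auto simp: ones_def)
  then show ?thesis using assms(1) * by (auto simp: bad_def)
qed

section \<open>Counting bad shifts\<close>

lemma card_balanced_subsets_le:
  "card {w. w \<subseteq> {..<2 * m} \<and> \<bar>2 * int (card w) - int (2 * m)\<bar> \<le> 2 * int k}
    \<le> (2 * k + 1) * ((2 * m) choose m)"
proof -
  have "{w. w \<subseteq> {..<2 * m} \<and> \<bar>2 * int (card w) - int (2 * m)\<bar> \<le> 2 * int k}
      \<subseteq> (\<Union>c\<in>{m - k..m + k}. {w. w \<subseteq> {..<2 * m} \<and> card w = c})" by auto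
  then have "card {w. w \<subseteq> {..<2 * m} \<and> \<bar>2 * int (card w) - int (2 * m)\<bar> \<le> 2 * int k}
      \<le> card (\<Union>c\<in>{m - k..m + k}. {w. w \<subseteq> {..<2 * m} \<and> card w = c})"
    by (intro card_mono) (auto intro: finite_subset[of _ "Pow {..<2 * m}"])
  also have "\<dots> \<le> (\<Sum>c\<in>{m - k..m + k}. card {w. w \<subseteq> {..<2 * m} \<and> card w = c})"
    by (rule card_UN_le) simp
  also have "\<dots> = (\<Sum>c\<in>{m - k..m + k}. (2 * m) choose c)"
    by (simp add: n_subsets)
  also have "\<dots> \<le> (\<Sum>c\<in>{m - k..m + k}. (2 * m) choose m)"
    by (intro sum_mono binomial_maximum')
  also have "\<dots> = (Suc (m + k) - (m - k)) * ((2 * m) choose m)" by simp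
  also have "\<dots> \<le> (2 * k + 1) * ((2 * m) choose m)" by (intro mult_right_mono) auto
  finally show ?thesis .
qed

definition shifts :: "nat \<Rightarrow> nat \<Rightarrow> (nat set \<times> nat) set" where
  "shifts d M = Pow {..<d} \<times> {..<M}"

lemma finite_shifts [simp]: "finite (shifts d M)" by (simp add: shifts_def)

lemma card_shifts: "card (shifts d M) = 2 ^ d * M"
  by (simp add: shifts_def card_cartesian_product card_Pow)

text \<open>The first term bounds instability: each of the \<open>2 * m\<close> coordinates spoils
  at most one translation. The second bounds near balance: for a fixed translation the bit pattern
  runs injectively through the cube as \<open>u\<close> varies.\<close>

lemma card_bad_shifts_le:
  assumes "M > 0"
  shows "card {t \<in> shifts (2 * m) M. bad k (2 * m) M a t n}
    \<le> 2 ^ (2 * m) * (2 * m) + (2 * k + 1) * ((2 * m) choose m) * M"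
proof -
  let ?d = "2 * m"
  let ?S = "\<Union>i<?d. {s. s < M \<and> \<not> frac_safe M (real n * a i + real s / real M)}"
  let ?bal = "\<lambda>u s. \<bar>2 * int (card (ones ?d M a (u, s) n)) - int ?d\<bar> \<le> 2 * int k"
  let ?U = "\<lambda>s. {u. u \<subseteq> {..<?d} \<and> ?bal u s}"
  have "card ?S \<le> (\<Sum>i<?d. card {s. s < M \<and> \<not> frac_safe M (real n * a i + real s / real M)})"
    by (rule card_UN_le) simp
  also have "\<dots> \<le> (\<Sum>i<?d. 1)" by (intro sum_mono card_not_frac_safe_le_1 assms)
  finally have S: "card ?S \<le> ?d" by simp
  have finS: "finite ?S" by simp
  have U: "card (?U s) \<le> (2 * k + 1) * (?d choose m)" for s
  proof -
    let ?O = "{i. i < ?d \<and> odd \<lfloor>real n * a i + real s / real M\<rfloor>}"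
    have o: "ones ?d M a (u, s) n = sym_diff ?O u" if "u \<subseteq> {..<?d}" for u
      using that by (auto simp: ones_def)
    have "inj_on (sym_diff ?O) (?U s)" by (rule inj_onI) blast
    moreover have "sym_diff ?O ` ?U s \<subseteq> {w. w \<subseteq> {..<?d} \<and> \<bar>2 * int (card w) - int ?d\<bar> \<le> 2 * int k}"
      using o by auto
    moreover have "finite {w. w \<subseteq> {..<?d} \<and> \<bar>2 * int (card w) - int ?d\<bar> \<le> 2 * int k}"
      by (rule finite_subset[of _ "Pow {..<?d}"]) auto
    ultimately have "card (?U s) \<le> card {w. w \<subseteq> {..<?d} \<and> \<bar>2 * int (card w) - int ?d\<bar> \<le> 2 * int k}"
      by (rule card_inj_on_le)
    also note card_balanced_subsets_le
    finally show ?thesis .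
  qed
  have finU: "finite (?U s)" for s by (rule finite_subset[of _ "Pow {..<?d}"]) auto
  have cs: "card (A \<times> {s}) = card A" for A :: "nat set set" and s :: nat
    by (simp add: card_cartesian_product)
  let ?V = "\<Union>s<M. ?U s \<times> {s}"
  have "card ?V \<le> (\<Sum>s<M. card (?U s \<times> {s}))" by (rule card_UN_le) simp
  also have "\<dots> \<le> (\<Sum>s<M. (2 * k + 1) * (?d choose m))"
    by (intro sum_mono) (use U in \<open>simp only: cs\<close>)
  finally have V: "card ?V \<le> (2 * k + 1) * (?d choose m) * M" by (simp add: mult.commute)
  have finV: "finite ?V" using finU by blast
  have "{t \<in> shifts ?d M. bad k ?d M a t n} \<subseteq> Pow {..<?d} \<times> ?S \<union> ?V"
    by (auto simp: shifts_def bad_def)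
  then have "card {t \<in> shifts ?d M. bad k ?d M a t n} \<le> card (Pow {..<?d} \<times> ?S \<union> ?V)"
    by (rule card_mono[rotated]) (use finS finV in blast)
  also have "\<dots> \<le> card (Pow {..<?d} \<times> ?S) + card ?V" by (rule card_Un_le)
  also have "card (Pow {..<?d} \<times> ?S) = 2 ^ ?d * card ?S"
    by (simp add: card_cartesian_product card_Pow)
  also have "2 ^ ?d * card ?S + card ?V \<le> 2 ^ ?d * ?d + (2 * k + 1) * (?d choose m) * M"
    using S V by (intro add_mono mult_left_mono) auto
  finally show ?thesis .
qed

text \<open>First \<open>m\<close> makes the balanced patterns rare, then \<open>M\<close> is taken
  large compared with \<open>m\<close>. The bound is uniform in the rotation \<open>a\<close>, so
  \<open>d\<close> and \<open>M\<close> can be fixed before the rotations are known.\<close>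

lemma exists_rare_bad_parameters:
  fixes e :: real
  assumes "e > 0"
  shows "\<exists>d M. k < d \<and> M > 0 \<and>
     (\<forall>a n. real (card {t \<in> shifts d M. bad k d M a t n}) \<le> e * real (card (shifts d M)))"
proof -
  obtain m where m: "m \<ge> k + 1" "real ((2 * m) choose m) \<le> e / (2 * (2 * real k + 1)) * 4 ^ m"
    using central_binomial_small[of "e / (2 * (2 * real k + 1))" "k + 1"] assms by auto
  obtain M :: nat where M: "2 * (2 * real m) / e < real M" using reals_Archimedean2 by blast
  have "0 \<le> 2 * (2 * real m) / e" using assms by simp
  then have Mpos: "M > 0" using M by linarith
  have *: "real (2 * m) \<le> e / 2 * real M" using M assms by (simp add: field_simps)
  have **: "(2 * real k + 1) * real ((2 * m) choose m) \<le> e / 2 * 4 ^ m"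
  proof -
    have "(2 * real k + 1) * real ((2 * m) choose m)
        \<le> (2 * real k + 1) * (e / (2 * (2 * real k + 1)) * 4 ^ m)"
      by (rule mult_left_mono[OF m(2)]) simp
    also have "\<dots> = e / 2 * 4 ^ m"
    proof -
      have "q * (e / (2 * q) * x) = e / 2 * x" if "q > 0" for q x :: real using that by simp
      from this[of "2 * real k + 1" "4 ^ m"] show ?thesis by linarith
    qed
    finally show ?thesis .
  qed
  have "real (card {t \<in> shifts (2 * m) M. bad k (2 * m) M a t n}) \<le> e * real (card (shifts (2 * m) M))" for a n
  proof -
    have "real (card {t \<in> shifts (2 * m) M. bad k (2 * m) M a t n})
        \<le> real (2 ^ (2 * m) * (2 * m) + (2 * k + 1) * ((2 * m) choose m) * M)"
      using card_bad_shifts_le[OF Mpos] of_nat_le_iff by blast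
    also have "\<dots> = 4 ^ m * real (2 * m) + (2 * real k + 1) * real ((2 * m) choose m) * real M"
      using power_mult[of "2::real" 2 m] by (simp add: algebra_simps)
    also have "\<dots> \<le> 4 ^ m * (e / 2 * real M) + e / 2 * 4 ^ m * real M"
      by (intro add_mono mult_left_mono mult_right_mono * **) auto
    also have "\<dots> = e * real (card (shifts (2 * m) M))"
      using power_mult[of "2::real" 2 m] by (simp add: card_shifts)
    finally show ?thesis .
  qed
  then show ?thesis using m(1) Mpos by (intro exI[of _ "2 * m"] exI[of _ M]) auto
qed

section \<open>Construction of the levels\<close>

text \<open>Nested intervals; the points \<open>e v\<close> do not depend on the parity pattern \<open>p\<close>, because the lengths
  of the intervals do not.\<close>

lemma simultaneous_parity_approximation:
  fixes h l :: real
  assumes "infinite E" "0 < h" "h \<le> 1" "finite V" "0 < l"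
  shows "\<exists>e. (\<forall>v\<in>V. e v \<in> E) \<and> (\<forall>a p. \<exists>x. a \<le> x \<and> x \<le> a + l \<and>
     (\<forall>v\<in>V. \<exists>z::int. (odd z \<longleftrightarrow> p v) \<and> \<bar>real (e v) * x - of_int z\<bar> \<le> h))"
  using assms(4,5)
proof (induction V arbitrary: l)
  case empty
  then show ?case by (auto intro!: exI[of _ "\<lambda>_. undefined"] intro: order_refl)
next
  case (insert v V)
  \<comment> \<open>The constant is \<open>2 + 1\<close>: an integer of prescribed parity lies
    within \<open>2\<close> above \<open>e0 * a\<close>, and the error \<open>h\<close> is at most
    \<open>1\<close>.\<close>
  obtain N :: nat where N: "3 / l < real N" using reals_Archimedean2 by blast
  obtain e0 where e0: "e0 \<in> E" "N < e0" using assms(1) by (meson infinite_nat_iff_unbounded)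
  have "3 / l < real e0" using N e0(2) by simp
  then have e0l: "3 < real e0 * l" using insert.prems by (simp add: field_simps)
  have e0pos: "real e0 > 0" using e0(2) by simp
  \<comment> \<open>On an interval of length \<open>h / e0\<close> the product \<open>e0 * x\<close>
    moves by at most \<open>h\<close>, so the condition at \<open>v\<close> survives the later
    refinements.\<close>
  obtain e where e: "\<forall>v\<in>V. e v \<in> E"
    "\<And>a p. \<exists>x. a \<le> x \<and> x \<le> a + h / real e0 \<and>
     (\<forall>v\<in>V. \<exists>z::int. (odd z \<longleftrightarrow> p v) \<and> \<bar>real (e v) * x - of_int z\<bar> \<le> h)"
    using insert.IH[of "h / real e0"] assms(2) e0pos by auto
  let ?e = "e(v := e0)"
  have "\<exists>x. a \<le> x \<and> x \<le> a + l \<and>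
     (\<forall>w\<in>insert v V. \<exists>z::int. (odd z \<longleftrightarrow> p w) \<and> \<bar>real (?e w) * x - of_int z\<bar> \<le> h)" for a p
  proof -
    define z where "z = (if odd \<lceil>real e0 * a\<rceil> = p v then \<lceil>real e0 * a\<rceil> else \<lceil>real e0 * a\<rceil> + 1)"
    have z: "odd z \<longleftrightarrow> p v" "real e0 * a \<le> of_int z" "of_int z \<le> real e0 * a + 2"
      unfolding z_def by (auto; linarith)+
    obtain x where x: "of_int z / real e0 \<le> x" "x \<le> of_int z / real e0 + h / real e0"
      "\<forall>v\<in>V. \<exists>z::int. (odd z \<longleftrightarrow> p v) \<and> \<bar>real (e v) * x - of_int z\<bar> \<le> h"
      using e(2) by blast
    have x1: "of_int z \<le> real e0 * x" "real e0 * x \<le> of_int z + h"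
      using x(1,2) e0pos by (auto simp: field_simps)
    have "real e0 * a \<le> real e0 * x" using x1 z by linarith
    then have "a \<le> x" using e0pos by (simp add: mult_le_cancel_left_pos)
    moreover have "real e0 * x \<le> real e0 * (a + l)" using x1 z e0l assms(3) by (simp add: distrib_left)
    then have "x \<le> a + l" using e0pos by (simp add: mult_le_cancel_left_pos)
    moreover have "\<bar>real e0 * x - of_int z\<bar> \<le> h" using x1 assms(2) by simp
    ultimately show ?thesis using x(3) z(1) insert.hyps(2)
      by (intro exI[of _ x]) auto
  qed
  then show ?case using e(1) e0(1) by (intro exI[of _ ?e]) auto
qed

text \<open>Pigeonhole on the circle modulo 2: if the fractional parts of \<open>n * x / 2\<close>
  lie in a common cell of length \<open>1 / (4 * M)\<close>, the differences times \<open>x\<close>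
  are within \<open>1 / (2 * M)\<close> of an even integer.\<close>

lemma infinite_near_even_differences:
  assumes "infinite E" "finite J" "\<forall>p\<in>J. fst p > 0"
  shows "\<exists>E'\<subseteq>E. infinite E' \<and>
    (\<forall>m\<in>E'. \<forall>n\<in>E'. m < n \<longrightarrow> (\<forall>(M, x)\<in>J. near_even M (real (n - m) * x)))"
  using assms(2,3)
proof (induction J)
  case empty
  then show ?case using assms(1) by auto
next
  case (insert p J)
  obtain M x where p: "p = (M, x)" by fastforce
  have M: "M > 0" using insert.prems p by auto
  obtain E' where E': "E' \<subseteq> E" "infinite E'"
    "\<And>m n. m \<in> E' \<Longrightarrow> n \<in> E' \<Longrightarrow> m < n \<Longrightarrow> \<forall>(M, x)\<in>J. near_even M (real (n - m) * x)"
  proof -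
    have "\<exists>E'\<subseteq>E. infinite E' \<and>
      (\<forall>m\<in>E'. \<forall>n\<in>E'. m < n \<longrightarrow> (\<forall>(M, x)\<in>J. near_even M (real (n - m) * x)))"
      by (rule insert.IH) (use insert.prems in simp)
    then show ?thesis using that by (elim exE conjE) simp
  qed
  define f where "f n = \<lfloor>4 * real M * frac (real n * x / 2)\<rfloor>" for n :: nat
  have "f n \<in> {0..<4 * int M}" for n
  proof -
    have "0 \<le> 4 * real M * frac (real n * x / 2)" by simp
    moreover have "4 * real M * frac (real n * x / 2) < 4 * real M"
      using M frac_lt_1[of "real n * x / 2"] by (simp add: mult_less_cancel_left2)
    ultimately show ?thesis by (simp add: f_def floor_less_iff)
  qed
  then have "f ` E' \<subseteq> {0..<4 * int M}" by blast
  then have "finite (f ` E')" by (rule finite_subset) simp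
  then obtain n0 where n0: "infinite {n \<in> E'. f n = f n0}" using pigeonhole_infinite[OF E'(2)] by blast
  have "near_even M (real (n - m) * x)" if "f m = f n" "m < n" for m n
  proof -
    let ?a = "real m * x / 2" and ?b = "real n * x / 2"
    have "\<bar>4 * real M * frac ?b - 4 * real M * frac ?a\<bar> < 1"
    proof -
      have "\<bar>w - u\<bar> < 1" if "\<lfloor>u\<rfloor> = \<lfloor>w\<rfloor>" for u w :: real using that by linarith
      then show ?thesis using that(1) unfolding f_def by blast
    qed
    moreover have "4 * real M * frac ?b - 4 * real M * frac ?a = 2 * real M * (2 * (frac ?b - frac ?a))"
      by (simp add: algebra_simps)
    ultimately have "2 * real M * \<bar>2 * (frac ?b - frac ?a)\<bar> < 1" by (simp add: abs_mult)
    then have "\<bar>2 * (frac ?b - frac ?a)\<bar> < 1 / (2 * real M)" using M by (simp add: field_simps)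
    moreover have "2 * (frac ?b - frac ?a) = real (n - m) * x - of_int (2 * (\<lfloor>?b\<rfloor> - \<lfloor>?a\<rfloor>))"
      using that(2) by (simp add: frac_def of_nat_diff algebra_simps)
    ultimately show ?thesis unfolding near_even_def
      by (intro exI[of _ "2 * (\<lfloor>?b\<rfloor> - \<lfloor>?a\<rfloor>)"]) auto
  qed
  then show ?case using E' n0 p by (intro exI[of _ "{n \<in> E'. f n = f n0}"]) auto
qed

lemma near_even_small: "0 \<le> x \<Longrightarrow> x < 1 / (2 * real M) \<Longrightarrow> near_even M x"
  unfolding near_even_def by (intro exI[of _ 0]) auto

text \<open>\<open>J\<close> collects the earlier coordinates and \<open>Q\<close> the earlier
  differences. Taking the new points in \<open>E'\<close> protects the earlier tori from
  \<open>R\<close>; taking the angles \<open>a i\<close> tiny protects the new torus from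
  \<open>Q\<close>.\<close>

lemma exists_next_level:
  assumes E: "infinite E" and Q: "finite Q" and J: "finite J" "\<forall>p\<in>J. fst p > 0"
    and kd: "k < d" and M: "M > 0"
  shows "\<exists>a R. finite R \<and> R \<subseteq> {1..} \<and> (\<forall>i<d. 0 \<le> a i \<and> real k * a i < 1 / (2 * real M))
    \<and> (\<forall>r\<in>Q. \<forall>i<d. near_even M (real r * a i))
    \<and> (\<forall>r\<in>R. \<forall>(N, x)\<in>J. near_even N (real r * x))
    \<and> (\<forall>r\<in>R. (\<forall>i<d. near_even M (real r * a i) \<or> near_odd M (real r * a i))
          \<and> d \<le> card {i. i < d \<and> near_odd M (real r * a i)} + k)
    \<and> (\<forall>c :: nat \<Rightarrow> nat. (\<forall>n\<in>E. c n < k) \<longrightarrow> (\<exists>m\<in>E. \<exists>n\<in>E. m < n \<and> c m = c n \<and> n - m \<in> R))"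
proof -
  obtain E' where E': "E' \<subseteq> E" "infinite E'"
    "\<And>m n. m \<in> E' \<Longrightarrow> n \<in> E' \<Longrightarrow> m < n \<Longrightarrow> \<forall>(N, x)\<in>J. near_even N (real (n - m) * x)"
    using infinite_near_even_differences[OF E J] by (elim exE conjE) simp
  define B where "B = Max (insert k Q)"
  have B: "r \<le> B" if "r \<in> insert k Q" for r using Q that unfolding B_def by (intro Max_ge) auto
  \<comment> \<open>Multiplying an angle in \<open>[0, l]\<close> by a number up to \<open>B\<close>
    keeps it below the tolerance \<open>1 / (2 * M)\<close>.\<close>
  define l where "l = 1 / (2 * real M * (real B + 1))"
  \<comment> \<open>A difference of two points doubles the error, and \<open>2 * h\<close> is still
    below the tolerance.\<close>
  define h where "h = 1 / (8 * real M)"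
  have h: "0 < h" "h \<le> 1" "2 * h < 1 / (2 * real M)" "2 * h < 1" using M by (auto simp: h_def field_simps)
  have l: "0 < l" using M by (simp add: l_def add_nonneg_pos)
  obtain e where e: "\<And>v. v \<in> Pow {..<d} \<Longrightarrow> e v \<in> E'" and app: "\<And>a p. \<exists>x. a \<le> x \<and> x \<le> a + l \<and>
     (\<forall>v\<in>Pow {..<d}. \<exists>z::int. (odd z \<longleftrightarrow> p v) \<and> \<bar>real (e v) * x - of_int z\<bar> \<le> h)"
    using simultaneous_parity_approximation[OF E'(2) h(1,2) _ l, of "Pow {..<d}"] by auto
  \<comment> \<open>Coordinate \<open>i\<close> uses the pattern "\<open>i\<close> belongs to
    \<open>v\<close>", so the parities at \<open>e v\<close> spell out the cube point
    \<open>v\<close>.\<close>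
  have "\<exists>x. 0 \<le> x \<and> x \<le> l \<and>
     (\<forall>v\<in>Pow {..<d}. \<exists>z::int. (odd z \<longleftrightarrow> i \<in> v) \<and> \<bar>real (e v) * x - of_int z\<bar> \<le> h)" for i
    using app[of 0 "\<lambda>v. i \<in> v"] by simp
  then obtain a where a: "\<And>i. 0 \<le> a i" "\<And>i. a i \<le> l"
    "\<And>i v. v \<in> Pow {..<d} \<Longrightarrow> \<exists>z::int. (odd z \<longleftrightarrow> i \<in> v) \<and> \<bar>real (e v) * a i - of_int z\<bar> \<le> h"
    by metis
  have small: "real r * a i < 1 / (2 * real M)" if "r \<in> insert k Q" for r i
  proof -
    have "real r * a i \<le> real B * l" using B[OF that] a(1,2) by (intro mult_mono) auto
    also have "\<dots> < (real B + 1) * l" using l by simp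
    also have "\<dots> = 1 / (2 * real M)"
    proof -
      have "q * (1 / (y * q)) = 1 / y" if "q > 0" for q y :: real using that by simp
      from this[of "real B + 1" "2 * real M"] show ?thesis by (simp add: l_def)
    qed
    finally show ?thesis .
  qed
  have diff: "\<exists>z::int. (odd z \<longleftrightarrow> i \<in> sym_diff v w) \<and> \<bar>(real (e v) - real (e w)) * a i - of_int z\<bar> \<le> 2 * h"
    if vw: "v \<in> Pow {..<d}" "w \<in> Pow {..<d}" for v w i
  proof -
    obtain y :: int where y: "odd y \<longleftrightarrow> i \<in> v" "\<bar>real (e v) * a i - of_int y\<bar> \<le> h"
      using a(3)[OF vw(1), of i] by (elim exE conjE) (rule that)
    obtain z :: int where z: "odd z \<longleftrightarrow> i \<in> w" "\<bar>real (e w) * a i - of_int z\<bar> \<le> h"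
      using a(3)[OF vw(2), of i] by (elim exE conjE) (rule that)
    have "odd (y - z) \<longleftrightarrow> i \<in> sym_diff v w" using y(1) z(1) by auto
    moreover have "\<bar>(real (e v) - real (e w)) * a i - of_int (y - z)\<bar> \<le> 2 * h"
      using y(2) z(2) unfolding left_diff_distrib of_int_diff by linarith
    ultimately show ?thesis by blast
  qed
  define R where "R = (\<lambda>(v, w). e v - e w) `
    {(v, w). v \<in> Pow {..<d} \<and> w \<in> Pow {..<d} \<and> e w < e v \<and> d - k < card (sym_diff v w)}"
  have RE: "\<exists>v\<in>Pow {..<d}. \<exists>w\<in>Pow {..<d}. e w < e v \<and> r = e v - e w \<and> d - k < card (sym_diff v w)"
    if "r \<in> R" for r using that by (auto simp: R_def)
  have "finite R" unfolding R_def
    by (rule finite_imageI, rule finite_subset[of _ "Pow {..<d} \<times> Pow {..<d}"]) auto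
  moreover have "R \<subseteq> {1..}" by (auto simp: R_def)
  moreover have "\<forall>(N, x)\<in>J. near_even N (real r * x)" if r: "r \<in> R" for r
  proof -
    obtain v w where "v \<in> Pow {..<d}" "w \<in> Pow {..<d}" "e w < e v" "r = e v - e w"
      using RE[OF r] by blast
    then show ?thesis using E'(3)[OF e e] by simp
  qed
  moreover have "(\<forall>i<d. near_even M (real r * a i) \<or> near_odd M (real r * a i))
      \<and> d \<le> card {i. i < d \<and> near_odd M (real r * a i)} + k" if r: "r \<in> R" for r
  proof -
    obtain v w where vw: "v \<in> Pow {..<d}" "w \<in> Pow {..<d}" "e w < e v" "r = e v - e w"
      "d - k < card (sym_diff v w)" using RE[OF r] by blast
    have rr: "real r = real (e v) - real (e w)" using vw by (simp add: of_nat_diff)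
    have *: "(i \<in> sym_diff v w \<longrightarrow> near_odd M (real r * a i)) \<and> (i \<notin> sym_diff v w \<longrightarrow> near_even M (real r * a i))" for i
      using diff[OF vw(1,2), of i] h(3) unfolding rr near_odd_def near_even_def
      by (meson le_less_trans)
    have "sym_diff v w \<subseteq> {i. i < d \<and> near_odd M (real r * a i)}" using * vw by blast
    then have "card (sym_diff v w) \<le> card {i. i < d \<and> near_odd M (real r * a i)}"
      by (intro card_mono) auto
    then show ?thesis using * vw(5) by auto
  qed
  moreover have "\<exists>m\<in>E. \<exists>n\<in>E. m < n \<and> c m = c n \<and> n - m \<in> R" if c: "\<forall>n\<in>E. c n < k" for c :: "nat \<Rightarrow> nat"
  proof -
    have "c (e v) < k" if "v \<subseteq> {..<d}" for v using c e E'(1) that by blast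
    then obtain v w where vw: "v \<subseteq> {..<d}" "w \<subseteq> {..<d}" "c (e v) = c (e w)" "d - k < card (sym_diff v w)"
      using cube_coloring_far_pair[of d "\<lambda>v. c (e v)" k] kd by auto
    \<comment> \<open>Otherwise \<open>0\<close> would be within \<open>2 * h < 1\<close> of an odd
      integer.\<close>
    have ne: "e v \<noteq> e w"
    proof
      assume eq: "e v = e w"
      have "sym_diff v w \<noteq> {}" using vw(4) by (metis card.empty not_less_zero)
      then obtain i where "i \<in> sym_diff v w" by blast
      then obtain z :: int where "odd z" "\<bar>real_of_int z\<bar> \<le> 2 * h"
        using diff[of v w i] vw(1,2) eq by auto
      then have "\<bar>real_of_int z\<bar> < 1" using h(4) by linarith
      then have "z = 0" by linarith
      then show False using \<open>odd z\<close> by simp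
    qed
    have R1: "e v - e w \<in> R" if "v \<subseteq> {..<d}" "w \<subseteq> {..<d}" "e w < e v" "d - k < card (sym_diff v w)" for v w
      unfolding R_def using that by (intro image_eqI[of _ _ "(v, w)"]) auto
    have inE: "e v \<in> E" "e w \<in> E" using e E'(1) vw by blast+
    show ?thesis
    proof (cases "e w < e v")
      case True
      then show ?thesis using R1[of v w] vw inE by metis
    next
      case False
      then have "e v < e w" using ne by simp
      moreover have "d - k < card (sym_diff w v)" using vw(4) by (simp add: Un_commute)
      ultimately show ?thesis using R1[of w v] vw inE by metis
    qed
  qed
  moreover have "\<forall>i<d. 0 \<le> a i \<and> real k * a i < 1 / (2 * real M)" using a(1) small by blast
  moreover have "\<forall>r\<in>Q. \<forall>i<d. near_even M (real r * a i)"
    using a(1) small by (auto intro!: near_even_small)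
  ultimately show ?thesis by (intro exI[of _ a] exI[of _ R]) simp
qed

text \<open>Recursion over the levels. Of two levels the later one is responsible for both
  interactions, so the final condition on \<open>j\<close> and \<open>k\<close> is
  symmetric.\<close>

lemma exists_levels:
  assumes E: "infinite E" and d: "\<And>k. k < d k" and M: "\<And>k :: nat. M k > 0"
  shows "\<exists>a R. \<forall>k. R k \<subseteq> {1..} \<and> (\<forall>i<d k. 0 \<le> a k i \<and> real k * a k i < 1 / (2 * real (M k)))
    \<and> (\<forall>j. j \<noteq> k \<longrightarrow> (\<forall>r\<in>R j. \<forall>i<d k. near_even (M k) (real r * a k i)))
    \<and> (\<forall>r\<in>R k. (\<forall>i<d k. near_even (M k) (real r * a k i) \<or> near_odd (M k) (real r * a k i))
          \<and> d k \<le> card {i. i < d k \<and> near_odd (M k) (real r * a k i)} + k)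
    \<and> (\<forall>c :: nat \<Rightarrow> nat. (\<forall>n\<in>E. c n < k) \<longrightarrow> (\<exists>m\<in>E. \<exists>n\<in>E. m < n \<and> c m = c n \<and> n - m \<in> R k))"
proof -
  define P where "P f k x \<longleftrightarrow> finite (snd x) \<and> snd x \<subseteq> {1..}
    \<and> (\<forall>i<d k. 0 \<le> fst x i \<and> real k * fst x i < 1 / (2 * real (M k)))
    \<and> (\<forall>r\<in>(\<Union>j<k. snd (f j)). \<forall>i<d k. near_even (M k) (real r * fst x i))
    \<and> (\<forall>r\<in>snd x. \<forall>(N, y)\<in>(\<Union>j<k. (\<lambda>i. (M j, fst (f j) i)) ` {..<d j}). near_even N (real r * y))
    \<and> (\<forall>r\<in>snd x. (\<forall>i<d k. near_even (M k) (real r * fst x i) \<or> near_odd (M k) (real r * fst x i))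
          \<and> d k \<le> card {i. i < d k \<and> near_odd (M k) (real r * fst x i)} + k)
    \<and> (\<forall>c :: nat \<Rightarrow> nat. (\<forall>n\<in>E. c n < k) \<longrightarrow> (\<exists>m\<in>E. \<exists>n\<in>E. m < n \<and> c m = c n \<and> n - m \<in> snd x))"
    for f :: "nat \<Rightarrow> (nat \<Rightarrow> real) \<times> nat set" and k x
  have "\<exists>f. \<forall>k. P f k (f k)"
  proof (rule dependent_wf_choice[of less_than])
    fix f g :: "nat \<Rightarrow> (nat \<Rightarrow> real) \<times> nat set" and k x
    assume "\<And>j. (j, k) \<in> less_than \<Longrightarrow> f j = g j"
    then have "(\<Union>j<k. snd (f j)) = (\<Union>j<k. snd (g j))"
      "(\<Union>j<k. (\<lambda>i. (M j, fst (f j) i)) ` {..<d j}) = (\<Union>j<k. (\<lambda>i. (M j, fst (g j) i)) ` {..<d j})"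
      by (auto intro!: SUP_cong)
    then show "P f k x = P g k x" unfolding P_def by (simp only:)
  next
    fix k and f :: "nat \<Rightarrow> (nat \<Rightarrow> real) \<times> nat set"
    assume prev: "\<And>j. (j, k) \<in> less_than \<Longrightarrow> P f j (f j)"
    have "finite (\<Union>j<k. snd (f j))" using prev by (auto simp: P_def)
    moreover have "finite (\<Union>j<k. (\<lambda>i. (M j, fst (f j) i)) ` {..<d j})" by simp
    moreover have "\<forall>p\<in>(\<Union>j<k. (\<lambda>i. (M j, fst (f j) i)) ` {..<d j}). fst p > 0" using M by auto
    ultimately have "\<exists>a R. P f k (a, R)"
      unfolding P_def fst_conv snd_conv by (rule exists_next_level[OF E _ _ _ d M])
    then show "\<exists>x. P f k x" by blast
  qed simp
  then obtain f where f: "\<And>k. P f k (f k)" by blast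
  have "near_even (M k) (real r * fst (f k) i)" if "j \<noteq> k" "r \<in> snd (f j)" "i < d k" for j k r i
  proof (cases "j < k")
    case True
    then have "r \<in> (\<Union>j<k. snd (f j))" using that by blast
    moreover have "\<forall>r\<in>(\<Union>j<k. snd (f j)). \<forall>i<d k. near_even (M k) (real r * fst (f k) i)"
      using f[of k] unfolding P_def by (elim conjE)
    ultimately show ?thesis using that(3) by blast
  next
    case False
    then have "(M k, fst (f k) i) \<in> (\<Union>k<j. (\<lambda>i. (M k, fst (f k) i)) ` {..<d k})" using that by auto
    moreover have "\<forall>r\<in>snd (f j). \<forall>(N, y)\<in>(\<Union>k<j. (\<lambda>i. (M k, fst (f k) i)) ` {..<d k}). near_even N (real r * y)"
      using f[of j] unfolding P_def by (elim conjE)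
    ultimately show ?thesis using that(2) by blast
  qed
  then show ?thesis using f unfolding P_def
    by (intro exI[of _ "\<lambda>k. fst (f k)"] exI[of _ "\<lambda>k. snd (f k)"]) simp
qed

section \<open>Compactness\<close>

lemma majority_sets_intersect:
  assumes "finite T" "A \<subseteq> T" "B \<subseteq> T" "card T < 2 * card A" "card T < 2 * card B"
  shows "A \<inter> B \<noteq> {}"
proof
  assume "A \<inter> B = {}"
  then have "card A + card B = card (A \<union> B)"
    using assms by (metis card_Un_disjoint finite_subset)
  also have "\<dots> \<le> card T" using assms by (intro card_mono) auto
  finally show False using assms by simp
qed

text \<open>Any two of the sets \<open>G i N\<close> meet, so the next finitely many coordinates of \<open>t\<close> can be good for
  one chosen \<open>N1\<close> and, by pigeonhole, for infinitely many later \<open>N'\<close>.\<close>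

lemma diagonal_majority_step:
  fixes G :: "nat \<Rightarrow> nat \<Rightarrow> 'a set"
  assumes fin: "\<And>i. finite (T i)" and sub: "\<And>i N. G i N \<subseteq> T i"
    and maj: "\<And>i N. card (T i) < 2 * card (G i N)"
    and X: "infinite X" and t: "\<And>i N'. i < N \<Longrightarrow> N' \<in> X \<Longrightarrow> t i \<in> G i N'"
  shows "\<exists>N1 X1 t1. N < N1 \<and> infinite X1 \<and> (\<forall>i<N. t1 i = t i)
    \<and> (\<forall>i<N1. t1 i \<in> G i N1) \<and> (\<forall>i<N1. \<forall>N'\<in>X1. t1 i \<in> G i N')"
proof -
  obtain N1 where N1: "N1 \<in> X" "N < N1" using X by (meson infinite_nat_iff_unbounded)
  have "\<exists>s. s \<in> G i N1 \<inter> G i N'" for i N'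
    using majority_sets_intersect[OF fin sub sub maj maj] by blast
  then obtain s where s: "\<And>i N'. s i N' \<in> G i N1 \<inter> G i N'" by metis
  define h where "h N' = restrict (\<lambda>i. s i N') {..<N1}" for N'
  have "h ` X \<subseteq> PiE {..<N1} T"
    using s sub by (force simp: h_def)
  then have "finite (h ` X)" using fin by (meson finite_PiE finite_lessThan finite_subset)
  then obtain N0 where N0: "infinite {N' \<in> X. h N' = h N0}"
    using pigeonhole_infinite[OF X] by blast
  let ?X1 = "{N' \<in> X. h N' = h N0}"
  define t1 where "t1 i = (if i < N then t i else s i N0)" for i
  have same: "s i N' = s i N0" if "N' \<in> ?X1" "i < N1" for i N'
  proof -
    have "h N' i = h N0 i" using that by simp
    then show ?thesis using that by (simp add: h_def)
  qed
  have "t1 i \<in> G i N1" if "i < N1" for i using s t N1 by (auto simp: t1_def)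
  moreover have "t1 i \<in> G i N'" if "i < N1" "N' \<in> ?X1" for i N'
    using t s[of i N'] same[OF that(2,1)] that by (auto simp: t1_def)
  ultimately show ?thesis using N0 N1(2)
    by (intro exI[of _ N1] exI[of _ ?X1] exI[of _ t1]) (auto simp: t1_def)
qed

lemma diagonal_majority_choice:
  fixes G :: "nat \<Rightarrow> nat \<Rightarrow> 'a set"
  assumes fin: "\<And>i. finite (T i)" and sub: "\<And>i N. G i N \<subseteq> T i"
    and maj: "\<And>i N. card (T i) < 2 * card (G i N)"
    and late: "\<And>i N N'. N \<le> i \<Longrightarrow> G i N' \<subseteq> G i N"
  shows "\<exists>t. infinite {N. \<forall>i. t i \<in> G i N}"
proof -
  define P where "P = (\<lambda>(N, X, t). infinite X \<and> (\<forall>i<N. t i \<in> G i N) \<and> (\<forall>i<N. \<forall>N'\<in>X. t i \<in> G i N'))"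
  define Q where "Q = (\<lambda>(N :: nat, X :: nat set, t) (N1 :: nat, X1 :: nat set, t1). N < N1 \<and> (\<forall>i<N. t1 i = (t i :: 'a)))"
  have "\<exists>f. \<forall>n. P (f n) \<and> Q (f n) (f (Suc n))"
  proof (rule dependent_nat_choice)
    show "\<exists>x. P x"
      by (rule exI[of _ "(0, UNIV, \<lambda>_. undefined)"]) (simp add: P_def)
  next
    fix x :: "nat \<times> nat set \<times> (nat \<Rightarrow> 'a)" and n :: nat
    assume px: "P x"
    obtain N X t where x: "x = (N, X, t)" by (cases x) auto
    with px have "infinite X" "\<And>i N'. i < N \<Longrightarrow> N' \<in> X \<Longrightarrow> t i \<in> G i N'" by (auto simp: P_def)
    from diagonal_majority_step[of T G X N t, OF fin sub maj this]
    obtain N1 X1 t1 where "N < N1 \<and> infinite X1 \<and> (\<forall>i<N. t1 i = t i)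
      \<and> (\<forall>i<N1. t1 i \<in> G i N1) \<and> (\<forall>i<N1. \<forall>N'\<in>X1. t1 i \<in> G i N')" by blast
    then show "\<exists>y. P y \<and> Q x y"
      by (intro exI[of _ "(N1, X1, t1)"]) (simp add: P_def Q_def x)
  qed
  then obtain f where f: "\<And>n. P (f n)" "\<And>n. Q (f n) (f (Suc n))" by blast
  define N where "N n = fst (f n)" for n
  define t where "t n = snd (snd (f n))" for n
  have good: "t n i \<in> G i (N n)" if "i < N n" for n i
    using f(1)[of n] that by (auto simp: P_def N_def t_def split: prod.splits)
  have step: "N n < N (Suc n)" "i < N n \<Longrightarrow> t (Suc n) i = t n i" for n i
    using f(2)[of n] by (auto simp: Q_def N_def t_def split: prod.splits)
  have mono: "strict_mono N" using step(1) by (simp add: strict_mono_Suc_iff)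
  have keep: "t m i = t n i" if "n \<le> m" "i < N n" for m n i
    using that(1)
  proof (induction m rule: dec_induct)
    case (step m)
    have "N n \<le> N m" using mono step(1) by (simp add: strict_mono_less_eq)
    then show ?case using step that(2) \<open>\<And>n i. i < N n \<Longrightarrow> t (Suc n) i = t n i\<close> by simp
  qed simp
  have lt: "i < N (Suc i)" for i
    using strict_mono_imp_increasing[OF mono, of "Suc i"] by simp
  define u where "u i = t (Suc i) i" for i
  have u: "u i = t n i" if "i < N n" for i n
    using keep[of n "Suc i" i] keep[of "Suc i" n i] that lt[of i] unfolding u_def
    by (metis nat_le_linear)
  have "u i \<in> G i (N n)" for i n
  proof (cases "i < N n")
    case True
    then show ?thesis using good u by simp
  next
    case False
    then have "G i (N (Suc i)) \<subseteq> G i (N n)" by (intro late) simp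
    then show ?thesis using good[OF lt[of i]] by (auto simp: u_def)
  qed
  then have "range N \<subseteq> {N. \<forall>i. u i \<in> G i N}" by auto
  moreover have "infinite (range N)"
    using mono by (simp add: range_inj_infinite strict_mono_imp_inj_on)
  ultimately show ?thesis by (meson infinite_super)
qed

text \<open>A compactness principle: the colour of \<open>n\<close> is its limiting colour relative to a representative
  of the class of points whose colour comparison with \<open>n\<close> eventually stabilises.\<close>

lemma eventual_two_coloring:
  fixes S :: "nat \<Rightarrow> 'a \<Rightarrow> bool"
  shows "\<exists>f :: 'a \<Rightarrow> bool. \<forall>m n. (\<forall>\<^sub>F K in sequentially. S K m \<noteq> S K n) \<longrightarrow> f m \<noteq> f n"
proof -
  define E where "E m n \<longleftrightarrow> (\<forall>\<^sub>F K in sequentially. S K m = S K n)" for m n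
  define D where "D m n \<longleftrightarrow> (\<forall>\<^sub>F K in sequentially. S K m \<noteq> S K n)" for m n
  define rel where "rel m = (\<lambda>n. E m n \<or> D m n)" for m
  have EE: "E m x \<Longrightarrow> E n x \<Longrightarrow> E m n" and DD: "D m x \<Longrightarrow> D n x \<Longrightarrow> E m n"
    and ED: "E m x \<Longrightarrow> D n x \<Longrightarrow> D m n" and DE: "D m x \<Longrightarrow> E n x \<Longrightarrow> D m n" for m n x
    unfolding E_def D_def by (erule (1) eventually_elim2, blast)+
  have sym: "E m n \<Longrightarrow> E n m" "D m n \<Longrightarrow> D n m" for m n
    unfolding E_def D_def by (erule eventually_mono, blast)+
  have excl: "\<not> (E m n \<and> D m n)" for m n
  proof
    assume "E m n \<and> D m n"
    then have "\<forall>\<^sub>F K in sequentially. S K m = S K n \<and> S K m \<noteq> S K n"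
      unfolding E_def D_def by (simp only: eventually_conj_iff)
    then obtain K where "S K m = S K n \<and> S K m \<noteq> S K n"
      using eventually_happens'[OF sequentially_bot] by blast
    then show False by blast
  qed
  define rep where "rep n = (SOME x. rel n x)" for n
  define f where "f n \<longleftrightarrow> E n (rep n)" for n
  have rep: "rel n (rep n)" for n
    unfolding rep_def by (rule someI[of _ n]) (simp add: rel_def E_def)
  have "f m \<noteq> f n" if mn: "D m n" for m n
  proof -
    \<comment> \<open>\<open>rel\<close> is an equivalence relation, and \<open>rep n\<close>
      depends on \<open>n\<close> only through its class.\<close>
    have "rel m = rel n"
      unfolding rel_def using mn EE DD ED DE sym by (intro ext) meson
    then have r: "rep m = rep n" by (simp add: rep_def)
    show ?thesis using rep[of m] rep[of n] mn EE DD excl sym unfolding f_def rel_def r by meson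
  qed
  then show ?thesis unfolding D_def by blast
qed

section \<open>Density of the good numbers\<close>

locale level_system =
  fixes d M :: "nat \<Rightarrow> nat" and a :: "nat \<Rightarrow> nat \<Rightarrow> real" and R :: "nat \<Rightarrow> nat set"
  assumes M_pos: "M k > 0"
    and R_pos: "R k \<subseteq> {1..}"
    and a_small: "i < d k \<Longrightarrow> 0 \<le> a k i \<and> real k * a k i < 1 / (2 * real (M k))"
    and R_other: "j \<noteq> k \<Longrightarrow> r \<in> R j \<Longrightarrow> i < d k \<Longrightarrow> near_even (M k) (real r * a k i)"
    and R_parity: "r \<in> R k \<Longrightarrow> i < d k \<Longrightarrow>
      near_even (M k) (real r * a k i) \<or> near_odd (M k) (real r * a k i)"
    and R_odd: "r \<in> R k \<Longrightarrow> d k \<le> card {i. i < d k \<and> near_odd (M k) (real r * a k i)} + k"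
    and bad_rare: "real (card {t \<in> shifts (d k) (M k). bad k (d k) (M k) (a k) t n})
      \<le> (1 / 2) ^ (k + 4) * real (card (shifts (d k) (M k)))"
begin

abbreviation Bad :: "nat \<Rightarrow> nat set \<times> nat \<Rightarrow> nat \<Rightarrow> bool" where
  "Bad k \<equiv> bad k (d k) (M k) (a k)"

abbreviation Sh :: "nat \<Rightarrow> (nat set \<times> nat) set" where
  "Sh k \<equiv> shifts (d k) (M k)"

text \<open>Excluding \<open>Bad k t 0\<close> keeps all numbers up to \<open>k\<close> good at
  level \<open>k\<close>. The weights \<open>(1 / 2) ^ (k + 2)\<close> add up to
  \<open>1 / 2\<close> over all levels.\<close>

definition good_shifts :: "nat set \<Rightarrow> nat \<Rightarrow> nat \<Rightarrow> (nat set \<times> nat) set" where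
  "good_shifts F k N = {t \<in> Sh k. \<not> Bad k t 0 \<and>
     real (card {n \<in> F \<inter> {1..N}. Bad k t n}) \<le> (1 / 2) ^ (k + 2) * real (card (F \<inter> {1..N}))}"

lemma not_Bad_early:
  assumes "t \<in> Sh k" "\<not> Bad k t 0" "n \<le> k"
  shows "\<not> Bad k t n"
proof (rule not_bad_small[OF assms(2)])
  show "snd t < M k" using assms(1) by (auto simp: shifts_def)
  fix i assume i: "i < d k"
  have "real n * a k i \<le> real k * a k i" using a_small[OF i] assms(3) by (intro mult_right_mono) auto
  then show "0 \<le> a k i \<and> real n * a k i < 1 / (2 * real (M k))" using a_small[OF i] by linarith
qed

text \<open>For \<open>N \<le> k\<close> no number up to \<open>N\<close> is bad at level
  \<open>k\<close>, so the counting condition at \<open>N\<close> holds automatically.\<close>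

lemma good_shifts_late:
  assumes "N \<le> k" shows "good_shifts F k N' \<subseteq> good_shifts F k N"
proof
  fix t assume "t \<in> good_shifts F k N'"
  then have t: "t \<in> Sh k" "\<not> Bad k t 0" by (auto simp: good_shifts_def)
  have "{n \<in> F \<inter> {1..N}. Bad k t n} = {}" using not_Bad_early[OF t] assms by auto
  then have "real (card {n \<in> F \<inter> {1..N}. Bad k t n}) = 0" by (simp only: card.empty of_nat_0)
  also have "0 \<le> (1 / 2) ^ (k + 2) * real (card (F \<inter> {1..N}))" by simp
  finally show "t \<in> good_shifts F k N" unfolding good_shifts_def using t by blast
qed

text \<open>Markov's inequality over the shifts: at most a quarter of them exceed four times the
  bound on the average count, and at most \<open>1 / 16\<close> are bad at \<open>0\<close>.
  Together this is less than half.\<close>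

lemma card_good_shifts: "card (Sh k) < 2 * card (good_shifts F k N)"
proof -
  let ?T = "Sh k" and ?F = "F \<inter> {1..N}"
  define e :: real where "e = (1 / 2) ^ (k + 4)"
  have e: "0 < e" "e \<le> 1 / 16" "(1 / 2) ^ (k + 2) = 4 * e"
    using power_le_one[of "1 / 2 :: real" k] by (auto simp: e_def power_add power4_eq_xxxx power2_eq_square)
  let ?count = "\<lambda>t. card {n \<in> ?F. Bad k t n}"
  let ?X = "{t \<in> ?T. Bad k t 0}"
  let ?Y = "{t \<in> ?T. 4 * e * real (card ?F) < real (?count t)}"
  have Tpos: "real (card ?T) > 0" using M_pos by (simp add: card_shifts)
  have X: "real (card ?X) \<le> e * real (card ?T)" using bad_rare[of k 0] by (simp add: e_def)
  have Y: "real (card ?Y) \<le> real (card ?T) / 4"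
  proof (cases "card ?F = 0")
    case True
    then have "?F = {}" by simp
    then have "?Y = {}" by (simp only:) simp
    then show ?thesis by (simp only:) simp
  next
    case False
    have finF: "finite ?F" by simp
    have "(\<Sum>t\<in>?T. ?count t) = (\<Sum>t\<in>?T. \<Sum>n\<in>?F. of_bool (Bad k t n))"
      by (simp only: sum_of_bool_card[OF finF])
    also have "\<dots> = (\<Sum>n\<in>?F. \<Sum>t\<in>?T. of_bool (Bad k t n))" by (rule sum.swap)
    also have "\<dots> = (\<Sum>n\<in>?F. card {t \<in> ?T. Bad k t n})"
      by (simp only: sum_of_bool_card finite_shifts)
    finally have swap: "(\<Sum>t\<in>?T. ?count t) = (\<Sum>n\<in>?F. card {t \<in> ?T. Bad k t n})" .
    have "real (card ?Y) * (4 * e * real (card ?F)) = (\<Sum>t\<in>?Y. 4 * e * real (card ?F))" by simp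
    also have "\<dots> \<le> (\<Sum>t\<in>?Y. real (?count t))" by (intro sum_mono) simp
    also have "\<dots> \<le> (\<Sum>t\<in>?T. real (?count t))" by (intro sum_mono2) auto
    also have "\<dots> = real (\<Sum>t\<in>?T. ?count t)" by (rule of_nat_sum[symmetric])
    also have "\<dots> = (\<Sum>n\<in>?F. real (card {t \<in> ?T. Bad k t n}))" unfolding swap by (rule of_nat_sum)
    also have "\<dots> \<le> (\<Sum>n\<in>?F. e * real (card ?T))"
      using bad_rare by (intro sum_mono) (simp add: e_def)
    also have "\<dots> = real (card ?T) / 4 * (4 * e * real (card ?F))" by simp
    finally show ?thesis using e(1) False
      by (simp only: mult_le_cancel_right_pos mult_pos_pos zero_less_numeral of_nat_0_less_iff neq0_conv)
  qed
  have "?T - good_shifts F k N \<subseteq> ?X \<union> ?Y"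
    unfolding good_shifts_def e(3) by auto
  then have "card (?T - good_shifts F k N) \<le> card (?X \<union> ?Y)" by (intro card_mono) auto
  also have "\<dots> \<le> card ?X + card ?Y" by (rule card_Un_le)
  finally have "real (card (?T - good_shifts F k N)) \<le> real (card ?X) + real (card ?Y)" by linarith
  also have "\<dots> \<le> e * real (card ?T) + real (card ?T) / 4" using X Y by linarith
  also have "\<dots> < real (card ?T) / 2"
    using Tpos e(2) mult_right_mono[OF e(2), of "real (card ?T)"] by linarith
  finally have "real (card (?T - good_shifts F k N)) < real (card ?T) / 2" .
  moreover have "good_shifts F k N \<subseteq> ?T" by (auto simp: good_shifts_def)
  then have "card (?T - good_shifts F k N) + card (good_shifts F k N) = card ?T"
    by (metis card_Diff_subset card_mono finite_shifts finite_subset le_add_diff_inverse2)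
  ultimately show ?thesis by linarith
qed

lemma exists_shifts:
  "\<exists>t. infinite {N. \<forall>k. t k \<in> good_shifts F k N}"
  by (rule diagonal_majority_choice[where T = Sh])
    (use card_good_shifts good_shifts_late in \<open>auto simp: good_shifts_def\<close>)

lemma half_not_bad:
  assumes t: "\<And>k. t k \<in> good_shifts F k N"
  shows "real (card (F \<inter> {1..N})) \<le> 2 * real (card {n \<in> F \<inter> {1..N}. \<forall>k. \<not> Bad k (t k) n})"
proof -
  let ?F = "F \<inter> {1..N}" and ?V = "{n \<in> F \<inter> {1..N}. \<forall>k. \<not> Bad k (t k) n}"
  have early: "\<not> Bad k (t k) n" if "n \<le> k" for n k
    using t[of k] not_Bad_early that by (auto simp: good_shifts_def)
  \<comment> \<open>A level \<open>k \<ge> n\<close> is never bad at \<open>n\<close>, so only the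
    levels below \<open>N\<close> enter the union bound.\<close>
  have "?F - ?V \<subseteq> (\<Union>k<N. {n \<in> ?F. Bad k (t k) n})"
  proof
    fix n assume "n \<in> ?F - ?V"
    then obtain k where k: "n \<in> ?F" "Bad k (t k) n" by blast
    then have "k < n" using early by (meson not_le)
    then show "n \<in> (\<Union>k<N. {n \<in> ?F. Bad k (t k) n})" using k by auto
  qed
  then have "card (?F - ?V) \<le> card (\<Union>k<N. {n \<in> ?F. Bad k (t k) n})" by (intro card_mono) auto
  also have "\<dots> \<le> (\<Sum>k<N. card {n \<in> ?F. Bad k (t k) n})" by (rule card_UN_le) simp
  finally have "real (card (?F - ?V)) \<le> real (\<Sum>k<N. card {n \<in> ?F. Bad k (t k) n})"
    by (simp only: of_nat_le_iff)
  also have "\<dots> = (\<Sum>k<N. real (card {n \<in> ?F. Bad k (t k) n}))" by (rule of_nat_sum)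
  also have "\<dots> \<le> (\<Sum>k<N. (1 / 2) ^ (k + 2) * real (card ?F))"
    using t by (intro sum_mono) (auto simp: good_shifts_def)
  also have "\<dots> = (\<Sum>k<N. (1 / 2) ^ k) * (1 / 4) * real (card ?F)"
    by (simp add: sum_distrib_right power_add)
  also have "\<dots> \<le> 2 * (1 / 4) * real (card ?F)"
  proof (intro mult_right_mono)
    have "(\<Sum>k<N. (1 / 2) ^ k) = 2 * (1 - (1 / 2 :: real) ^ N)" by (simp add: sum_gp_strict)
    then show "(\<Sum>k<N. (1 / 2) ^ k) \<le> (2 :: real)" by simp
  qed auto
  finally have "real (card (?F - ?V)) \<le> real (card ?F) / 2" by simp
  moreover have "card (?F - ?V) + card ?V = card ?F"
    by (subst card_Diff_subset) (auto intro!: le_add_diff_inverse2 card_mono)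
  ultimately show ?thesis by linarith
qed

lemma majority_edge:
  assumes "\<And>k. \<not> Bad k (t k) m" "\<And>k. \<not> Bad k (t k) (m + r)" "r \<in> R k"
  shows "majority (d j) (M j) (a j) (t j) (m + r) \<longleftrightarrow> majority (d j) (M j) (a j) (t j) m \<noteq> (j = k)"
proof (cases "j = k")
  case True
  then show ?thesis
    using majority_add_near_odd[OF assms(1,2), of j] R_parity R_odd assms(3) by blast
next
  case False
  then show ?thesis
    using majority_add_near_even[OF assms(1,2), of j] R_other[of k j r] assms(3) by blast
qed

text \<open>The natural side of \<open>n\<close> is the parity of its majority bits over all levels,
  of which infinitely many may be set. The truncated parity \<open>S K\<close> separates an edge
  from \<open>R k\<close> as soon as \<open>K > k\<close>, and \<open>eventual_two_coloring\<close>
  turns this into one colouring.\<close>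

lemma not_E_intersective:
  assumes F: "F \<subseteq> {1..}" "infinite F"
  shows "\<not> E_intersective F (\<Union>k. R k)"
proof -
  obtain t where t: "infinite {N. \<forall>k. t k \<in> good_shifts F k N}" using exists_shifts by blast
  define V where "V = {n \<in> F. \<forall>k. \<not> Bad k (t k) n}"
  define maj where "maj j n = majority (d j) (M j) (a j) (t j) n" for j n
  define S where "S K n = even (card {j. j < K \<and> maj j n})" for K n
  obtain f :: "nat \<Rightarrow> bool"
    where f: "\<And>m n. (\<forall>\<^sub>F K in sequentially. S K m \<noteq> S K n) \<Longrightarrow> f m \<noteq> f n"
    using eventual_two_coloring[of S] by blast
  have edge: "f m \<noteq> f (m + r)" if m: "m \<in> V" "m + r \<in> V" and r: "r \<in> R k" for m r k
  proof (rule f)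
    have "S K m \<noteq> S K (m + r)" if "K > k" for K
    proof -
      have "maj j (m + r) \<longleftrightarrow> maj j m \<noteq> (j = k)" for j
        unfolding maj_def by (rule majority_edge[OF _ _ r]) (use m in \<open>auto simp: V_def\<close>)
      then have *: "{j. j < K \<and> maj j (m + r)} = (if maj k m then {j. j < K \<and> maj j m} - {k}
          else insert k {j. j < K \<and> maj j m})" using \<open>K > k\<close> by auto
      show ?thesis
      proof (cases "maj k m")
        case True
        then have "card {j. j < K \<and> maj j m} = Suc (card ({j. j < K \<and> maj j m} - {k}))"
          using \<open>K > k\<close> by (intro card.remove) auto
        then show ?thesis using True by (simp add: S_def *)
      next
        case False
        then show ?thesis by (simp add: S_def *)
      qed
    qed
    then show "\<forall>\<^sub>F K in sequentially. S K m \<noteq> S K (m + r)"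
      unfolding eventually_sequentially by (meson Suc_le_lessD)
  qed
  define A where "A b = {n \<in> V. f n = b}" for b
  have AF: "A b \<subseteq> F" for b by (auto simp: A_def V_def)
  have avoid: "int ` (\<Union>k. R k) \<inter> difference_set (A b) = {}" for b
  proof (rule ccontr)
    assume "int ` (\<Union>k. R k) \<inter> difference_set (A b) \<noteq> {}"
    then obtain r k m n where r: "r \<in> R k" "m \<in> A b" "n \<in> A b" "int r = int n - int m"
      unfolding difference_set_def by auto
    then have "n = m + r" by simp
    then show False using edge[OF _ _ r(1), of m] r(2,3) by (auto simp: A_def)
  qed
  define c where "c X N = card (X \<inter> F \<inter> {1..N})" for X N
  let ?big = "\<lambda>b. {N. card (F \<inter> {1..N}) \<le> 4 * c (A b) N}"
  have "{N. \<forall>k. t k \<in> good_shifts F k N} \<subseteq> ?big True \<union> ?big False"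
  proof
    fix N assume "N \<in> {N. \<forall>k. t k \<in> good_shifts F k N}"
    then have "real (card (F \<inter> {1..N})) \<le> 2 * real (card {n \<in> F \<inter> {1..N}. \<forall>k. \<not> Bad k (t k) n})"
      using half_not_bad by simp
    moreover have "{n \<in> F \<inter> {1..N}. \<forall>k. \<not> Bad k (t k) n} = (A True \<inter> F \<inter> {1..N}) \<union> (A False \<inter> F \<inter> {1..N})"
      by (auto simp: A_def V_def)
    then have "card {n \<in> F \<inter> {1..N}. \<forall>k. \<not> Bad k (t k) n} \<le> c (A True) N + c (A False) N"
      unfolding c_def by (simp only: card_Un_le)
    ultimately show "N \<in> ?big True \<union> ?big False" by auto
  qed
  then have "infinite (?big True \<union> ?big False)" using t infinite_super by blast
  then have "infinite (?big True) \<or> infinite (?big False)" by (simp only: finite_Un de_Morgan_conj)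
  then obtain b where b: "infinite (?big b)" by blast
  have "rel_upper_density F (A b) \<ge> ereal (1 / 4)"
  proof (rule ccontr)
    assume "\<not> ?thesis"
    then have "rel_upper_density F (A b) < ereal (1 / 4)" by simp
    then have "\<forall>\<^sub>F N in sequentially. ereal (real (c (A b) N) / real (card (F \<inter> {1..N}))) < ereal (1 / 4)"
      unfolding rel_upper_density_def c_def by (rule Limsup_lessD)
    then obtain N0 where N0: "\<And>N. N \<ge> N0 \<Longrightarrow> ereal (real (c (A b) N) / real (card (F \<inter> {1..N}))) < ereal (1 / 4)"
      unfolding eventually_sequentially by blast
    \<comment> \<open>Passing a point of \<open>F\<close> makes the denominator positive, so
      division by zero cannot occur.\<close>
    obtain p where p: "p \<in> F" using F(2) by (metis all_not_in_conv finite.emptyI)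
    obtain N where N: "N \<in> ?big b" "N > max N0 p" using b by (meson infinite_nat_iff_unbounded)
    have "p \<in> F \<inter> {1..N}" using p N F(1) by auto
    then have "card (F \<inter> {1..N}) > 0" by (auto simp: card_gt_0_iff)
    then have "1 / 4 \<le> real (c (A b) N) / real (card (F \<inter> {1..N}))"
      using N(1) by (simp add: field_simps)
    moreover have "real (c (A b) N) / real (card (F \<inter> {1..N})) < 1 / 4"
      using N0[of N] N(2) by simp
    ultimately show False by simp
  qed
  moreover have "(0 :: ereal) < ereal (1 / 4)" by simp
  ultimately have "rel_upper_density F (A b) > 0" by (rule less_le_trans[rotated])
  show ?thesis
  proof
    assume "E_intersective F (\<Union>k. R k)"
    then have "int ` (\<Union>k. R k) \<inter> difference_set (A b) \<noteq> {}"
      unfolding E_intersective_def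
      by (rule allE[of _ "A b"]) (erule mp, intro conjI AF \<open>rel_upper_density F (A b) > 0\<close>)
    then show False using avoid by (rule notE)
  qed
qed

end

section \<open>From colourings to partitions, and the conclusion\<close>

lemma chromatically_E_intersectiveI:
  assumes "\<And>(c :: nat \<Rightarrow> nat) k. (\<And>n. n \<in> E \<Longrightarrow> c n < k) \<Longrightarrow> \<exists>m\<in>E. \<exists>n\<in>E. m < n \<and> c m = c n \<and> n - m \<in> R"
  shows "chromatically_E_intersective E R"
  unfolding chromatically_E_intersective_def
proof (intro allI impI)
  fix P assume P: "finite P \<and> partition_on E P"
  obtain g where g: "bij_betw g P {0..<card P}" using P ex_bij_betw_finite_nat by blast
  have "\<exists>C\<in>P. n \<in> C" if "n \<in> E" for n using P that by (auto simp: partition_on_def)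
  then obtain part where part: "\<And>n. n \<in> E \<Longrightarrow> part n \<in> P \<and> n \<in> part n" by metis
  have "g (part n) < card P" if "n \<in> E" for n using bij_betwE[OF g] part[OF that] by auto
  then obtain m n where mn: "m \<in> E" "n \<in> E" "m < n" "g (part m) = g (part n)" "n - m \<in> R"
    using assms[of "\<lambda>n. g (part n)"] by blast
  have "part m = part n"
    using g part[OF mn(1)] part[OF mn(2)] mn(4) by (auto simp: bij_betw_def dest: inj_onD)
  then have "int n - int m \<in> difference_set (part n)"
    using part[OF mn(1)] part[OF mn(2)] by (auto simp: difference_set_def)
  moreover have "int n - int m \<in> int ` R" using mn(3,5) by (intro image_eqI[of _ _ "n - m"]) auto
  ultimately show "\<exists>C\<in>P. int ` R \<inter> difference_set C \<noteq> {}" using part[OF mn(2)] by blast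
qed

theorem theoremE:
  fixes E :: "nat set"
  assumes "E \<subseteq> {1..}" and "infinite E"
  shows "\<exists>R \<subseteq> {1..}. chromatically_E_intersective E R \<and> \<not> intersective R \<and> \<not> E_intersective E R"
proof -
  \<comment> \<open>The bound \<open>(1 / 2) ^ (k + 4)\<close> is a quarter of the weight allowed in
    \<open>good_shifts\<close>, which leaves room for Markov's inequality.\<close>
  have "\<exists>d M. k < d \<and> M > 0 \<and> (\<forall>a n. real (card {t \<in> shifts d M. bad k d M a t n})
      \<le> (1 / 2) ^ (k + 4) * real (card (shifts d M)))" for k
    by (rule exists_rare_bad_parameters) simp
  then have "\<exists>d. \<forall>k. \<exists>M. k < d k \<and> M > 0 \<and> (\<forall>a n. real (card {t \<in> shifts (d k) M. bad k (d k) M a t n})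
      \<le> (1 / 2) ^ (k + 4) * real (card (shifts (d k) M)))"
    by (intro choice allI)
  then obtain d where "\<forall>k. \<exists>M. k < d k \<and> M > 0 \<and>
      (\<forall>a n. real (card {t \<in> shifts (d k) M. bad k (d k) M a t n})
      \<le> (1 / 2) ^ (k + 4) * real (card (shifts (d k) M)))" ..
  from choice[OF this] obtain M where dM: "\<And>k. k < d k" "\<And>k. M k > 0"
    "\<And>k a n. real (card {t \<in> shifts (d k) (M k). bad k (d k) (M k) a t n})
      \<le> (1 / 2) ^ (k + 4) * real (card (shifts (d k) (M k)))" by auto
  obtain a R where aR: "\<forall>k. R k \<subseteq> {1..} \<and> (\<forall>i<d k. 0 \<le> a k i \<and> real k * a k i < 1 / (2 * real (M k)))
    \<and> (\<forall>j. j \<noteq> k \<longrightarrow> (\<forall>r\<in>R j. \<forall>i<d k. near_even (M k) (real r * a k i)))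
    \<and> (\<forall>r\<in>R k. (\<forall>i<d k. near_even (M k) (real r * a k i) \<or> near_odd (M k) (real r * a k i))
          \<and> d k \<le> card {i. i < d k \<and> near_odd (M k) (real r * a k i)} + k)
    \<and> (\<forall>c :: nat \<Rightarrow> nat. (\<forall>n\<in>E. c n < k) \<longrightarrow> (\<exists>m\<in>E. \<exists>n\<in>E. m < n \<and> c m = c n \<and> n - m \<in> R k))"
    using exists_levels[where d = d and M = M, OF assms(2) dM(1,2)] by (elim exE)
  interpret level_system d M a R
  proof
    show "M k > 0" for k by (rule dM(2))
    show "R k \<subseteq> {1..}" for k using aR[THEN spec[of _ k]] by (elim conjE)
    show "0 \<le> a k i \<and> real k * a k i < 1 / (2 * real (M k))" if "i < d k" for i k
      using aR[THEN spec[of _ k]] that by (elim conjE) simp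
    show "near_even (M k) (real r * a k i)" if "j \<noteq> k" "r \<in> R j" "i < d k" for j k r i
      using aR[THEN spec[of _ k]] that by (elim conjE) simp
    show "near_even (M k) (real r * a k i) \<or> near_odd (M k) (real r * a k i)"
      if "r \<in> R k" "i < d k" for r k i
      using aR[THEN spec[of _ k]] that by (elim conjE) simp
    show "d k \<le> card {i. i < d k \<and> near_odd (M k) (real r * a k i)} + k" if "r \<in> R k" for r k
      using aR[THEN spec[of _ k]] that by (elim conjE) simp
  qed (rule dM(3))
  \<comment> \<open>A colouring with \<open>k\<close> colours is already handled by the differences
    of level \<open>k\<close>.\<close>
  have "chromatically_E_intersective E (\<Union>k. R k)"
  proof (rule chromatically_E_intersectiveI)
    fix c :: "nat \<Rightarrow> nat" and k
    assume "\<And>n. n \<in> E \<Longrightarrow> c n < k"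
    then have "\<exists>m\<in>E. \<exists>n\<in>E. m < n \<and> c m = c n \<and> n - m \<in> R k" using aR by simp
    then show "\<exists>m\<in>E. \<exists>n\<in>E. m < n \<and> c m = c n \<and> n - m \<in> (\<Union>k. R k)" by blast
  qed
  \<comment> \<open>The same levels serve for every infinite set of positive integers, so both
    failures follow from one lemma.\<close>
  moreover have "\<not> intersective (\<Union>k. R k)"
    unfolding intersective_def by (rule not_E_intersective) (auto simp: infinite_Ici)
  moreover have "\<not> E_intersective E (\<Union>k. R k)" by (rule not_E_intersective[OF assms])
  moreover have "(\<Union>k. R k) \<subseteq> {1..}" using R_pos by blast
  ultimately show ?thesis by blast
qed

end
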